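(* Let $X=(X_1,\dots,X_{n+1})$ be an $(n+1)$-class birth and death process with strictly positive (constant) birth rates $\lambda_1,\dots,\lambda_{n+1}$ and bounded death rates $\phi_1,\dots,\phi_{n+1}:\mathbb{Z}_+^{n+1}\to\mathbb{R}_+$ such that $\phi_i(x)=\phi_i(x_1,\dots,x_n)$ only depends on the first $n$ input arguments for all $i=1,\dots,n+1$. Assume that: (i) The Markov process $X^n=(X_1,\dots,X_n)$ is stable and has the stationary distribution $\pi$. (ii) The birth rate of $X_{n+1}$ satisfies $$\lambda_{n+1}>\sum_{x^n\in\mathbb{Z}_+^n}\phi_{n+1}(x^n)\,\pi(x^n).$$ Then the process $X_{n+1}$ is transient, regardless of the initial state of $X$.
   Context: $n\ge0$ is an integer; for $n=0$, $\mathbb{Z}_+^0$ is a single point, (i) is vacuous, and $\pi$ is the unit mass at that point. $\mathbb{Z}_+=\{0,1,2,\dots\}$, $\mathbb{R}_+=[0,\infty)$. An $N$-class birth and death process with birth rates $\lambda_i$ and death rates $\phi_i(x)$ is the continuous-time Markov process on $\mathbb{Z}_+^N$ (with right-continuous paths with left limits) having transitions $x\mapsto x+e_i$ at rate $\lambda_i$ and $x\mapsto x-e_i$ at rate $\phi_i(x)1(x_i>0)$, $i=1,\dots,N$, where $e_i$ is the $i$-th unit vector. A stochastic process $U$ with values in a countable space $S$ is stable if for every $\epsilon>0$ there is a finite set $K\subset S$ such that $\Pr(U(t)\notin K)\le\epsilon$ for all $t\ge0$. It is transient if $U(t)\to\infty$ almost surely, i.e. for every finite set $K\subset S$, $\Pr\big(\bigcup_{s\ge0}\bigcap_{t\ge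 s}\{U(t)\notin K\}\big)=1$. *)

theory Defs
  imports "HOL-Probability.Probability"
begin

section \<open>Markov processes with countable state space in continuous time\<close>

text \<open>
  Time is \<^typ>\<open>real\<close>, restricted to nonnegative values. The state space \<open>S\<close> carries the discrete
  topology, so that convergence of states means being eventually constant.
\<close>

definition transition_function :: "'s set \<Rightarrow> (real \<Rightarrow> 's \<Rightarrow> 's pmf) \<Rightarrow> bool" where
  "transition_function S P \<longleftrightarrow>
     (\<forall>t\<ge>0. \<forall>x\<in>S. set_pmf (P t x) \<subseteq> S) \<and>
     (\<forall>x\<in>S. P 0 x = return_pmf x) \<and>
     (\<forall>s\<ge>0. \<forall>t\<ge>0. \<forall>x\<in>S. P (s + t) x = bind_pmf (P s x) (P t))"

text \<open>
  \<open>P\<close> has transition rates \<open>q\<close>: from \<open>x\<close>, jumps to \<open>y \<noteq> x\<close> occur at rate \<open>q x y\<close>, and the total rate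
  of leaving \<open>x\<close> is the sum of these rates.
\<close>

definition has_transition_rates ::
  "'s set \<Rightarrow> (real \<Rightarrow> 's \<Rightarrow> 's pmf) \<Rightarrow> ('s \<Rightarrow> 's \<Rightarrow> real) \<Rightarrow> bool" where
  "has_transition_rates S P q \<longleftrightarrow>
     (\<forall>x\<in>S. \<forall>y\<in>S. x \<noteq> y \<longrightarrow> ((\<lambda>h. pmf (P h x) y / h) \<longlongrightarrow> q x y) (at_right 0)) \<and>
     (\<forall>x\<in>S. ((\<lambda>h. (1 - pmf (P h x) x) / h) \<longlongrightarrow> (\<Sum>\<^sub>\<infinity>y\<in>S - {x}. q x y)) (at_right 0))"

definition cadlag_path :: "(real \<Rightarrow> 's) \<Rightarrow> bool" where
  "cadlag_path f \<longleftrightarrow>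
     (\<forall>t\<ge>0. \<forall>\<^sub>F s in at_right t. f s = f t) \<and>
     (\<forall>t>0. \<exists>y. \<forall>\<^sub>F s in at_left t. f s = y)"

text \<open>
  The last conjunct is the Markov property with respect to the history of the process, in
  elementary form: given \<open>X (t 0) = x 0, \<dots>, X (t k) = x k\<close>, the conditional probability of
  \<open>X (t (Suc k)) = x (Suc k)\<close> is \<open>P (t (Suc k) - t k) (x k) (x (Suc k))\<close>. The law of \<open>X 0\<close> is arbitrary.
\<close>

definition markov_process ::
  "'w measure \<Rightarrow> 's set \<Rightarrow> (real \<Rightarrow> 's \<Rightarrow> 's pmf) \<Rightarrow> (real \<Rightarrow> 'w \<Rightarrow> 's) \<Rightarrow> bool" where
  "markov_process M S P X \<longleftrightarrow>
     prob_space M \<and>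
     transition_function S P \<and>
     (\<forall>t\<ge>0. X t \<in> measurable M (count_space S)) \<and>
     (\<forall>\<omega>\<in>space M. cadlag_path (\<lambda>t. X t \<omega>)) \<and>
     (\<forall>k (t :: nat \<Rightarrow> real) x.
        0 \<le> t 0 \<and> strict_mono_on {..Suc k} t \<and> (\<forall>i\<le>Suc k. x i \<in> S) \<longrightarrow>
          measure M {\<omega> \<in> space M. \<forall>i\<le>Suc k. X (t i) \<omega> = x i} =
          measure M {\<omega> \<in> space M. \<forall>i\<le>k. X (t i) \<omega> = x i}
            * pmf (P (t (Suc k) - t k) (x k)) (x (Suc k)))"

definition stable_process :: "'w measure \<Rightarrow> 's set \<Rightarrow> (real \<Rightarrow> 'w \<Rightarrow> 's) \<Rightarrow> bool" where
  "stable_process M S U \<longleftrightarrow>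
     (\<forall>\<epsilon>>0. \<exists>K. finite K \<and> K \<subseteq> S \<and> (\<forall>t\<ge>0. measure M {\<omega> \<in> space M. U t \<omega> \<notin> K} \<le> \<epsilon>))"

definition transient_process :: "'w measure \<Rightarrow> 's set \<Rightarrow> (real \<Rightarrow> 'w \<Rightarrow> 's) \<Rightarrow> bool" where
  "transient_process M S U \<longleftrightarrow>
     (\<forall>K. finite K \<and> K \<subseteq> S \<longrightarrow>
        measure M {\<omega> \<in> space M. \<exists>s\<ge>0. \<forall>t\<ge>s. U t \<omega> \<notin> K} = 1)"


section \<open>Multiclass birth and death processes\<close>

text \<open>
  A point of $\mathbb{Z}_+^N$ is a list of \<open>N\<close> natural numbers. Coordinates and classes are
  numbered from \<open>0\<close> to \<open>N - 1\<close>.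
\<close>

definition Zplus :: "nat \<Rightarrow> nat list set" where
  "Zplus N = {x. length x = N}"

text \<open>
  The (at most) \<open>2 N\<close> neighbours of \<open>x\<close> are distinct, so for given \<open>x\<close> and \<open>y\<close> at most one summand
  is nonzero.
\<close>

definition bd_rate ::
  "nat \<Rightarrow> (nat \<Rightarrow> real) \<Rightarrow> (nat \<Rightarrow> nat list \<Rightarrow> real) \<Rightarrow> nat list \<Rightarrow> nat list \<Rightarrow> real" where
  "bd_rate N b \<phi> x y =
     (\<Sum>i<N. (if y = x[i := x ! i + 1] then b i else 0) +
             (if x ! i > 0 \<and> y = x[i := x ! i - 1] then \<phi> i x else 0))"

definition birth_death_process ::
  "nat \<Rightarrow> (nat \<Rightarrow> real) \<Rightarrow> (nat \<Rightarrow> nat list \<Rightarrow> real) \<Rightarrow>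
     'w measure \<Rightarrow> (real \<Rightarrow> 'w \<Rightarrow> nat list) \<Rightarrow> bool" where
  "birth_death_process N b \<phi> M X \<longleftrightarrow>
     (\<exists>P. markov_process M (Zplus N) P X \<and> has_transition_rates (Zplus N) P (bd_rate N b \<phi>))"

text \<open>For bounded rates, the transition function \<open>P\<close> is uniquely determined on \<^term>\<open>Zplus N\<close>.\<close>

definition bd_stationary_distribution ::
  "nat \<Rightarrow> (nat \<Rightarrow> real) \<Rightarrow> (nat \<Rightarrow> nat list \<Rightarrow> real) \<Rightarrow> nat list pmf \<Rightarrow> bool" where
  "bd_stationary_distribution N b \<phi> \<pi> \<longleftrightarrow>
     set_pmf \<pi> \<subseteq> Zplus N \<and>
     (\<exists>P. transition_function (Zplus N) P \<and>
          has_transition_rates (Zplus N) P (bd_rate N b \<phi>) \<and>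
          (\<forall>t\<ge>0. bind_pmf \<pi> (P t) = \<pi>))"

end

theory Submission
  imports Defs
begin

text \<open>
  Let \<open>L\<close> be the generator of \<open>X\<close>, \<open>L\<^sub>n\<close> that of \<open>X\<^sup>n\<close>, and \<open>s(z, u)\<close> the probability that the uniformized
  chain started in \<open>(z, u)\<close> never enters \<open>{u \<le> k}\<close>. Its finite-horizon versions satisfy \<open>L s\<^sub>m \<le> 0\<close>
  above level \<open>k\<close>. Summing this over all levels and integrating over \<open>z\<close> against \<open>\<pi>\<close> kills \<open>L\<^sub>n\<close>, and
  the vertical part telescopes to \<open>\<lambda>\<^sub>n\<^sub>+\<^sub>1 (1 - \<pi> s\<^sub>m(\<cdot>, k + 1)) \<le> \<pi> \<phi>\<^sub>n\<^sub>+\<^sub>1\<close>, a maximal ergodic inequality. By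
  (ii), \<open>s(z, k + 1) > 0\<close> for some \<open>z\<close> with \<open>\<pi>(z) > 0\<close>. Stationarity and the positive birth rates
  make this \<open>z\<close> recurrent from every initial state of \<open>X\<^sup>n\<close>.

  The hitting probability \<open>h = 1 - s\<close> is superharmonic, hence excessive for every semigroup with these
  rates, and by the maximal inequality the process visits \<open>{u \<le> k}\<close> after time \<open>T\<close> with probability at
  most \<open>E h(Y\<^sub>T)\<close>. The limit of \<open>P\<^sub>T h\<close> as \<open>T\<close> grows is harmonic and dominated by \<open>h\<close>; it vanishes, because
  the recurrent line over \<open>z\<close> already yields its supremum, and there \<open>h\<close> stays away from \<open>1\<close>.
\<close>

section \<open>Generators and uniformized chains\<close>

definition bd_gen :: "nat \<Rightarrow> (nat \<Rightarrow> real) \<Rightarrow> (nat \<Rightarrow> nat list \<Rightarrow> real) \<Rightarrow> (nat list \<Rightarrow> real) \<Rightarrow> nat list \<Rightarrow> real" where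
  "bd_gen N b \<phi> f x = (\<Sum>i<N. b i * (f (x[i := x ! i + 1]) - f x) +
     (if x ! i > 0 then \<phi> i x * (f (x[i := x ! i - 1]) - f x) else 0))"

lemma Zplus_update [simp]: "x \<in> Zplus N \<Longrightarrow> x[i := v] \<in> Zplus N"
  by (simp add: Zplus_def)

lemma bd_gen_cong:
  assumes "\<And>x. x \<in> Zplus N \<Longrightarrow> f x = g x" "x \<in> Zplus N"
  shows "bd_gen N b \<phi> f x = bd_gen N b \<phi> g x"
  unfolding bd_gen_def using assms by (intro sum.cong) simp_all

lemma bd_gen_const [simp]: "bd_gen N b \<phi> (\<lambda>_. a) x = 0"
  unfolding bd_gen_def by (intro sum.neutral) simp

lemma bd_gen_add: "bd_gen N b \<phi> (\<lambda>x. f x + g x) x = bd_gen N b \<phi> f x + bd_gen N b \<phi> g x"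
  by (auto simp: bd_gen_def algebra_simps sum.distrib[symmetric] intro!: sum.cong)

lemma bd_gen_scale: "bd_gen N b \<phi> (\<lambda>x. a * f x) x = a * bd_gen N b \<phi> f x"
  by (auto simp: bd_gen_def algebra_simps sum_distrib_left intro!: sum.cong)

lemma bd_gen_diff: "bd_gen N b \<phi> (\<lambda>x. f x - g x) x = bd_gen N b \<phi> f x - bd_gen N b \<phi> g x"
  using bd_gen_add[of N b \<phi> f "\<lambda>x. (-1) * g x" x] bd_gen_scale[of N b \<phi> "-1" g x] by simp

lemma bd_gen_tendsto:
  assumes "\<And>x. x \<in> Zplus N \<Longrightarrow> (\<lambda>m. f m x) \<longlonglongrightarrow> g x" "x \<in> Zplus N"
  shows "(\<lambda>m. bd_gen N b \<phi> (f m) x) \<longlonglongrightarrow> bd_gen N b \<phi> g x"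
  unfolding bd_gen_def using assms
  by (intro tendsto_sum tendsto_add) (auto intro!: tendsto_intros)

text \<open>\<open>c\<close> bounds the total jump rate uniformly over all states; this makes
  \<open>f + gen f / c\<close> an average of values of \<open>f\<close>, that is, a Markov
  operator.\<close>

locale bd_rates =
  fixes N :: nat and b :: "nat \<Rightarrow> real" and \<phi> :: "nat \<Rightarrow> nat list \<Rightarrow> real" and B c :: real
  assumes birth_pos: "i < N \<Longrightarrow> 0 < b i"
    and death_nonneg: "i < N \<Longrightarrow> x \<in> Zplus N \<Longrightarrow> 0 \<le> \<phi> i x"
    and death_le: "i < N \<Longrightarrow> x \<in> Zplus N \<Longrightarrow> \<phi> i x \<le> B"
    and c_pos: "0 < c"
    and rates_le: "(\<Sum>i<N. b i + B) \<le> c"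
begin

abbreviation "gen \<equiv> bd_gen N b \<phi>"

definition "total_rate x = (\<Sum>i<N. b i + (if x ! i > 0 then \<phi> i x else 0))"

lemma B_nonneg: "i < N \<Longrightarrow> 0 \<le> B"
  using death_nonneg[of i "replicate N 0"] death_le[of i "replicate N 0"] by (simp add: Zplus_def)

lemma total_rate_le: "x \<in> Zplus N \<Longrightarrow> total_rate x \<le> c"
  unfolding total_rate_def
  by (rule order_trans[OF sum_mono rates_le]) (use death_le B_nonneg in auto)

text \<open>One step of the chain obtained by uniformization at rate \<open>c\<close>.\<close>

definition step :: "(nat list \<Rightarrow> real) \<Rightarrow> nat list \<Rightarrow> real" where
  "step f x = f x + gen f x / c"

lemma step_cong:
  "(\<And>x. x \<in> Zplus N \<Longrightarrow> f x = g x) \<Longrightarrow> x \<in> Zplus N \<Longrightarrow> step f x = step g x"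
  by (simp add: step_def cong: bd_gen_cong)

lemma step_const [simp]: "step (\<lambda>_. a) x = a"
  by (simp add: step_def)

lemma step_add: "step (\<lambda>x. f x + g x) x = step f x + step g x"
  by (simp add: step_def bd_gen_add add_divide_distrib)

lemma step_diff: "step (\<lambda>x. f x - g x) x = step f x - step g x"
  by (simp add: step_def bd_gen_diff diff_divide_distrib)

lemma step_scale: "step (\<lambda>x. a * f x) x = a * step f x"
  by (simp add: step_def bd_gen_scale algebra_simps)

lemma step_tendsto:
  assumes "\<And>x. x \<in> Zplus N \<Longrightarrow> (\<lambda>m. f m x) \<longlonglongrightarrow> g x" "x \<in> Zplus N"
  shows "(\<lambda>m. step (f m) x) \<longlonglongrightarrow> step g x"
  unfolding step_def using assms bd_gen_tendsto[OF assms] c_pos by (auto intro!: tendsto_intros)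

text \<open>At states of \<open>Zplus N\<close> all coefficients on the right are nonnegative by
  \<open>total_rate_le\<close>; positivity of \<open>step\<close>, and with it monotonicity, is read
  off from this form.\<close>

lemma step_eq:
  "c * step f x = (c - total_rate x) * f x +
     (\<Sum>i<N. b i * f (x[i := x ! i + 1]) + (if x ! i > 0 then \<phi> i x * f (x[i := x ! i - 1]) else 0))"
proof -
  have "gen f x + total_rate x * f x =
     (\<Sum>i<N. b i * f (x[i := x ! i + 1]) + (if x ! i > 0 then \<phi> i x * f (x[i := x ! i - 1]) else 0))"
    unfolding bd_gen_def total_rate_def sum_distrib_right sum.distrib[symmetric]
    by (intro sum.cong) (auto simp: algebra_simps)
  moreover have "c * step f x = c * f x + gen f x"
    using c_pos by (simp add: step_def field_simps)
  ultimately show ?thesis by (simp add: algebra_simps)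
qed

text \<open>Of the nonnegative terms in \<open>step_eq\<close>, only the birth of class
  \<open>i\<close> is kept.\<close>

lemma step_ge_birth:
  assumes f: "\<And>x. x \<in> Zplus N \<Longrightarrow> 0 \<le> f x" and x: "x \<in> Zplus N" and i: "i < N"
  shows "b i / c * f (x[i := x ! i + 1]) \<le> step f x"
proof -
  let ?g = "\<lambda>i. b i * f (x[i := x ! i + 1]) + (if x ! i > 0 then \<phi> i x * f (x[i := x ! i - 1]) else 0)"
  have "b i * f (x[i := x ! i + 1]) \<le> ?g i"
    using f x i death_nonneg[OF i x] by auto
  also have "\<dots> \<le> sum ?g {..<N}"
    using i f x death_nonneg[OF _ x] birth_pos by (intro member_le_sum) (auto intro!: add_nonneg_nonneg simp: less_imp_le)
  also have "\<dots> \<le> c * step f x"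
    unfolding step_eq using total_rate_le[OF x] f[OF x] by simp
  finally show ?thesis using c_pos by (simp add: field_simps)
qed

lemma step_nonneg:
  assumes f: "\<And>x. x \<in> Zplus N \<Longrightarrow> 0 \<le> f x" and x: "x \<in> Zplus N"
  shows "0 \<le> step f x"
proof -
  have "0 \<le> c * step f x"
    unfolding step_eq using total_rate_le[OF x] f x death_nonneg[OF _ x] birth_pos
    by (intro add_nonneg_nonneg sum_nonneg) (auto simp: less_imp_le)
  then show ?thesis using c_pos by (simp add: zero_le_mult_iff)
qed

lemma step_mono:
  assumes "\<And>x. x \<in> Zplus N \<Longrightarrow> f x \<le> g x" and "x \<in> Zplus N"
  shows "step f x \<le> step g x"
  using step_nonneg[of "\<lambda>x. g x - f x" x] assms by (simp add: step_diff)

text \<open>\<open>step\<close> preserves order and constants, so it is a contraction in the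
  supremum norm, and \<open>gen f\<close> is \<open>c\<close> times
  \<open>step f - f\<close>.\<close>

lemma gen_abs_le:
  assumes f: "\<And>x. x \<in> Zplus N \<Longrightarrow> \<bar>f x\<bar> \<le> C" and x: "x \<in> Zplus N"
  shows "\<bar>gen f x\<bar> \<le> 2 * C * c"
proof -
  have "\<bar>step f x\<bar> \<le> C"
    using step_mono[of f "\<lambda>_. C" x] step_mono[of "\<lambda>_. - C" f x] f x by (fastforce simp: abs_le_iff)
  then have "\<bar>step f x - f x\<bar> \<le> 2 * C" using f[OF x] by linarith
  moreover have "gen f x = (step f x - f x) * c" using c_pos by (simp add: step_def)
  ultimately show ?thesis using c_pos by (simp add: abs_mult)
qed

text \<open>\<open>\<rho> - v\<close> is nonnegative and harmonic at \<open>x\<close>, so a gap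
  below \<rho> after a birth is handed down, up to the factor \<open>b i / c\<close>, to the state
  before it.\<close>

lemma harmonic_birth:
  assumes v: "\<And>x. x \<in> Zplus N \<Longrightarrow> v x \<le> \<rho>" and x: "x \<in> Zplus N" "gen v x = 0" and i: "i < N"
  shows "b i / c * (\<rho> - v (x[i := x ! i + 1])) \<le> \<rho> - v x"
  using step_ge_birth[of "\<lambda>x. \<rho> - v x" x i] assms by (simp add: step_diff) (simp add: step_def)

text \<open>
  \<open>nohit A m x\<close> and \<open>avoid A x\<close> are the probabilities that the uniformized chain started in \<open>x\<close>
  avoids \<open>A\<close> during its first \<open>m\<close> steps, and forever.
\<close>

fun nohit :: "nat list set \<Rightarrow> nat \<Rightarrow> nat list \<Rightarrow> real" where
  "nohit A 0 x = (if x \<in> A then 0 else 1)"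
| "nohit A (Suc m) x = (if x \<in> A then 0 else step (nohit A m) x)"

definition avoid :: "nat list set \<Rightarrow> nat list \<Rightarrow> real" where
  "avoid A x = lim (\<lambda>m. nohit A m x)"

lemma nohit_in [simp]: "x \<in> A \<Longrightarrow> nohit A m x = 0"
  by (cases m) auto

lemma nohit_bounds: "x \<in> Zplus N \<Longrightarrow> 0 \<le> nohit A m x \<and> nohit A m x \<le> 1"
proof (induction m arbitrary: x)
  case (Suc m)
  then show ?case
    using step_mono[of "nohit A m" "\<lambda>_. 1" x] step_nonneg[of "nohit A m" x] by auto
qed auto

lemma nohit_Suc_le: "x \<in> Zplus N \<Longrightarrow> nohit A (Suc m) x \<le> nohit A m x"
proof (induction m arbitrary: x)
  case 0
  then show ?case using nohit_bounds[of x A "Suc 0"] by (auto simp del: nohit.simps(2))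
next
  case (Suc m)
  then show ?case by (subst (1 2) nohit.simps(2)) (auto intro!: step_mono simp del: nohit.simps)
qed

lemma nohit_decseq: "x \<in> Zplus N \<Longrightarrow> decseq (\<lambda>m. nohit A m x)"
  using nohit_Suc_le by (simp add: decseq_Suc_iff del: nohit.simps)

lemma nohit_tendsto: "x \<in> Zplus N \<Longrightarrow> (\<lambda>m. nohit A m x) \<longlonglongrightarrow> avoid A x"
  unfolding avoid_def
proof -
  assume x: "x \<in> Zplus N"
  obtain L where "(\<lambda>m. nohit A m x) \<longlonglongrightarrow> L"
    using decseq_convergent[OF nohit_decseq[OF x], of 0 A] nohit_bounds[OF x] by metis
  then show "(\<lambda>m. nohit A m x) \<longlonglongrightarrow> lim (\<lambda>m. nohit A m x)" by (simp add: limI)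
qed

lemma avoid_bounds: "x \<in> Zplus N \<Longrightarrow> 0 \<le> avoid A x \<and> avoid A x \<le> 1"
  using nohit_bounds LIMSEQ_le_const[OF nohit_tendsto] LIMSEQ_le_const2[OF nohit_tendsto] by metis

lemma avoid_abs_le: "x \<in> Zplus N \<Longrightarrow> \<bar>avoid A x\<bar> \<le> 1"
  using avoid_bounds[of x A] by simp

lemma avoid_in: "x \<in> A \<Longrightarrow> avoid A x = 0"
  by (simp add: avoid_def)

lemma avoid_step:
  assumes x: "x \<in> Zplus N" "x \<notin> A"
  shows "step (avoid A) x = avoid A x"
proof (rule LIMSEQ_unique)
  show "(\<lambda>m. step (nohit A m) x) \<longlonglongrightarrow> step (avoid A) x"
    by (intro step_tendsto nohit_tendsto x)
  show "(\<lambda>m. step (nohit A m) x) \<longlonglongrightarrow> avoid A x"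
    using LIMSEQ_Suc[OF nohit_tendsto[OF x(1), of A]] x by simp
qed

lemma gen_eq_0_iff: "gen f x = 0 \<longleftrightarrow> step f x = f x"
  using c_pos by (simp add: step_def)

lemma gen_avoid_eq_0: "x \<in> Zplus N \<Longrightarrow> x \<notin> A \<Longrightarrow> gen (avoid A) x = 0"
  by (simp add: gen_eq_0_iff avoid_step)

text \<open>On \<open>A\<close> the function takes its minimum 0, so averaging over a step can only
  increase it; off \<open>A\<close> it is harmonic.\<close>

lemma gen_avoid_nonneg: "x \<in> Zplus N \<Longrightarrow> 0 \<le> gen (avoid A) x"
proof (cases "x \<in> A")
  case True
  assume x: "x \<in> Zplus N"
  have "0 \<le> step (avoid A) x"
    using avoid_bounds x by (intro step_nonneg) auto
  then show ?thesis
    using True c_pos by (simp add: step_def avoid_in zero_le_divide_iff)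
qed (simp add: gen_avoid_eq_0)

text \<open>The submartingale inequality is iterated until the chain enters \<open>A\<close>: paths
  that have entered contribute at most \<open>a\<close>, the surviving ones at most
  \<open>a + d\<close>. Then the horizon tends to infinity.\<close>

lemma optional_stopping:
  assumes sub: "\<And>x. x \<in> Zplus N \<Longrightarrow> x \<notin> A \<Longrightarrow> v x \<le> step v x"
    and A: "\<And>x. x \<in> Zplus N \<Longrightarrow> x \<in> A \<Longrightarrow> v x \<le> a"
    and le: "\<And>x. x \<in> Zplus N \<Longrightarrow> v x \<le> a + d"
    and x: "x \<in> Zplus N"
  shows "v x \<le> a + d * avoid A x"
proof -
  have "v x \<le> a + d * nohit A m x" if "x \<in> Zplus N" for m x
    using that
  proof (induction m arbitrary: x)
    case 0
    then show ?case using A le by simp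
  next
    case (Suc m)
    show ?case
    proof (cases "x \<in> A")
      case False
      have "v x \<le> step v x" by (rule sub[OF Suc.prems False])
      also have "\<dots> \<le> step (\<lambda>x. a + d * nohit A m x) x"
        by (rule step_mono[OF Suc.IH Suc.prems])
      finally show ?thesis using False by (simp add: step_add step_scale)
    qed (use A Suc.prems in simp)
  qed
  then show ?thesis
    by (intro LIMSEQ_le_const[where X = "\<lambda>m. a + d * nohit A m x"])
      (auto intro!: tendsto_intros nohit_tendsto x)
qed

lemma birth_lower_bound:
  obtains \<beta> where "0 < \<beta>" "\<beta> \<le> 1" "\<And>i. i < N \<Longrightarrow> \<beta> \<le> b i / c"
proof
  \<comment> \<open>The inserted 1 keeps the set nonempty for \<open>N = 0\<close> and gives \<beta>
    \<le> 1, so that powers of \<beta> decrease.\<close>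
  let ?\<beta> = "Min (insert 1 ((\<lambda>i. b i / c) ` {..<N}))"
  show "0 < ?\<beta>" using birth_pos c_pos by (subst Min_gr_iff) auto
  show "?\<beta> \<le> 1" by simp
  show "?\<beta> \<le> b i / c" if "i < N" for i using that by (intro Min_le) auto
qed

text \<open>Harmonic functions below a constant that vanish at one state vanish above it; a uniform
  chance of reaching the orthant above \<open>z\<close> then forces them to vanish everywhere.\<close>

lemma harmonic_zero:
  assumes z: "z \<in> Zplus N" and harm: "\<And>x. x \<in> Zplus N \<Longrightarrow> gen v x = 0"
    and nonneg: "\<And>x. x \<in> Zplus N \<Longrightarrow> 0 \<le> v x" and le: "\<And>x. x \<in> Zplus N \<Longrightarrow> v x \<le> 1"
    and z0: "v z = 0" and x: "x \<in> Zplus N"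
  shows "v x = 0"
proof -
  have up: "v (x[i := x ! i + 1]) = 0" if "x \<in> Zplus N" "v x = 0" "i < N" for x i
  proof -
    have "b i / c * v (x[i := x ! i + 1]) \<le> step v x"
      using nonneg that by (intro step_ge_birth) auto
    also have "step v x = 0" using harm that by (simp add: step_def)
    finally show ?thesis
      using nonneg[of "x[i := x ! i + 1]"] that birth_pos[of i] c_pos
      by (simp add: mult_le_0_iff divide_le_0_iff)
  qed
  \<comment> \<open>Induction on the total excess over \<open>z\<close>: one unit is removed from
    some coordinate and restored as a birth, along which \<open>up\<close> carries the zero.\<close>
  have above: "v x = 0" if "x \<in> Zplus N" "\<And>i. i < N \<Longrightarrow> z ! i \<le> x ! i" for x
    using that
  proof (induction "\<Sum>i<N. x ! i - z ! i" arbitrary: x rule: less_induct)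
    case (less x)
    show ?case
    proof (cases "\<exists>i<N. z ! i < x ! i")
      case True
      then obtain i where i: "i < N" "z ! i < x ! i" by blast
      let ?y = "x[i := x ! i - Suc 0]"
      have nth: "?y ! j = (if j = i then x ! i - Suc 0 else x ! j)" if "j < N" for j
        using that less.prems by (simp add: Zplus_def nth_list_update)
      have "(\<Sum>i<N. ?y ! i - z ! i) < (\<Sum>i<N. x ! i - z ! i)"
        using i by (intro sum_strict_mono_ex1) (auto simp: nth intro!: bexI[of _ i])
      then have "v ?y = 0"
        using less.prems i by (intro less.hyps) (auto simp: nth)
      moreover have "?y[i := ?y ! i + 1] = x" using i less.prems by (simp add: Zplus_def)
      ultimately show ?thesis using up[of ?y i] i less.prems by simp
    next
      case False
      then have "x ! i = z ! i" if "i < N" for i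
        using less.prems(2)[OF that] that by (meson le_antisym not_less)
      then have "x = z" using less.prems(1) z by (intro nth_equalityI) (auto simp: Zplus_def)
      then show ?thesis using z0 by simp
    qed
  qed
  obtain \<beta> where \<beta>: "0 < \<beta>" "\<beta> \<le> 1" "\<And>i. i < N \<Longrightarrow> \<beta> \<le> b i / c"
    using birth_lower_bound by metis
  \<comment> \<open>Each birth still missing below \<open>z\<close> costs a factor \<beta>; once
    \<open>x\<close> dominates \<open>z\<close>, \<open>v\<close> vanishes and the whole gap \<rho>
    is available.\<close>
  have contract: "\<rho> - v x \<ge> \<beta> ^ (\<Sum>i<N. z ! i - x ! i) * \<rho>"
    if "x \<in> Zplus N" and \<rho>: "0 \<le> \<rho>" "\<And>x. x \<in> Zplus N \<Longrightarrow> v x \<le> \<rho>" for \<rho> x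
    using that(1)
  proof (induction "\<Sum>i<N. z ! i - x ! i" arbitrary: x rule: less_induct)
    case (less x)
    show ?case
    proof (cases "\<exists>i<N. x ! i < z ! i")
      case True
      then obtain i where i: "i < N" "x ! i < z ! i" by blast
      let ?y = "x[i := Suc (x ! i)]"
      have nth: "?y ! j = (if j = i then Suc (x ! i) else x ! j)" if "j < N" for j
        using that less.prems by (simp add: Zplus_def nth_list_update)
      have lt: "(\<Sum>i<N. z ! i - ?y ! i) < (\<Sum>i<N. z ! i - x ! i)"
        using i by (intro sum_strict_mono_ex1) (auto simp: nth intro!: bexI[of _ i])
      have "\<beta> ^ (\<Sum>i<N. z ! i - x ! i) * \<rho> \<le> \<beta> ^ Suc (\<Sum>i<N. z ! i - ?y ! i) * \<rho>"
        using lt \<beta> \<rho> by (intro mult_right_mono power_decreasing) auto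
      also have "\<dots> = \<beta> * (\<beta> ^ (\<Sum>i<N. z ! i - ?y ! i) * \<rho>)" by simp
      also have "\<dots> \<le> \<beta> * (\<rho> - v ?y)"
        using less.hyps[OF lt] less.prems \<beta> by (intro mult_left_mono) auto
      also have "\<dots> \<le> b i / c * (\<rho> - v ?y)"
        using \<beta>(3)[OF i(1)] \<rho> less.prems by (intro mult_right_mono) auto
      also have "\<dots> \<le> \<rho> - v x"
        using less.prems harm i \<rho> harmonic_birth[of v \<rho> x i] by simp
      finally show ?thesis .
    next
      case False
      then have "z ! i \<le> x ! i" if "i < N" for i using that by (meson not_less)
      then have "v x = 0" using above less.prems by blast
      moreover have "\<beta> ^ k * \<rho> \<le> \<rho>" for k
        using \<beta> \<rho> by (intro mult_left_le_one_le) (auto simp: power_le_one)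
      ultimately show ?thesis by simp
    qed
  qed
  define \<rho> where "\<rho> = (SUP x\<in>Zplus N. v x)"
  define \<epsilon> where "\<epsilon> = \<beta> ^ (\<Sum>i<N. z ! i)"
  have bdd: "bdd_above (v ` Zplus N)" using le by (auto intro!: bdd_aboveI)
  have le\<rho>: "v x \<le> \<rho>" if "x \<in> Zplus N" for x
    unfolding \<rho>_def using bdd that by (rule cSUP_upper2) simp
  have \<rho>0: "0 \<le> \<rho>" using le\<rho>[OF z] z0 by simp
  have "v x \<le> \<rho> * (1 - \<epsilon>)" if "x \<in> Zplus N" for x
  proof -
    \<comment> \<open>Truncated subtraction bounds the number of missing births by the sum of the
      entries of \<open>z\<close>, so one \<epsilon> serves every state.\<close>
    have "\<epsilon> \<le> \<beta> ^ (\<Sum>i<N. z ! i - x ! i)"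
      unfolding \<epsilon>_def using \<beta> by (intro power_decreasing sum_mono) auto
    then have "\<epsilon> * \<rho> \<le> \<beta> ^ (\<Sum>i<N. z ! i - x ! i) * \<rho>" using \<rho>0 by (rule mult_right_mono)
    then show ?thesis using contract[OF that \<rho>0 le\<rho>] by (simp add: algebra_simps)
  qed
  then have "\<rho> \<le> \<rho> * (1 - \<epsilon>)"
    using z unfolding \<rho>_def by (intro cSUP_least) auto
  moreover have "0 < \<epsilon>" using \<beta> by (simp add: \<epsilon>_def)
  ultimately have "\<rho> = 0" using \<rho>0 by (simp add: algebra_simps mult_le_0_iff)
  then show ?thesis using le\<rho>[OF x] nonneg[OF x] by simp
qed

end

section \<open>A class driven by the other classes\<close>

text \<open>A jump of one of the first \<open>n\<close> classes leaves \<open>u\<close> fixed and a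
  jump of class \<open>n\<close> leaves \<open>z\<close> fixed, so the generator splits into a
  horizontal and a vertical part.\<close>

lemma bd_gen_snoc:
  assumes z: "length z = n" and \<psi>: "\<And>i. i < Suc n \<Longrightarrow> \<phi> i (z @ [u]) = \<psi> i z"
  shows "bd_gen (Suc n) b \<phi> f (z @ [u]) = bd_gen n b \<psi> (\<lambda>z. f (z @ [u])) z +
    b n * (f (z @ [u + 1]) - f (z @ [u])) +
    (if u > 0 then \<psi> n z * (f (z @ [u - 1]) - f (z @ [u])) else 0)"
proof -
  have "(\<Sum>i<n. b i * (f ((z @ [u])[i := (z @ [u]) ! i + 1]) - f (z @ [u])) +
      (if (z @ [u]) ! i > 0 then \<phi> i (z @ [u]) * (f ((z @ [u])[i := (z @ [u]) ! i - 1]) - f (z @ [u])) else 0))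
    = bd_gen n b \<psi> (\<lambda>z. f (z @ [u])) z"
    unfolding bd_gen_def using z \<psi> by (intro sum.cong) (auto simp: list_update_append nth_append)
  then show ?thesis
    using z \<psi>[of n] by (simp add: bd_gen_def list_update_append nth_append)
qed

locale bd_extension =
  fixes n :: nat and b :: "nat \<Rightarrow> real" and \<phi> \<psi> :: "nat \<Rightarrow> nat list \<Rightarrow> real" and B c :: real
  assumes full: "bd_rates (Suc n) b \<phi> B c"
    and dep: "\<And>i x. i < Suc n \<Longrightarrow> x \<in> Zplus (Suc n) \<Longrightarrow> \<phi> i x = \<psi> i (take n x)"
begin

sublocale full: bd_rates "Suc n" b \<phi> B c
  by (rule full)

lemma snoc_Zplus [simp]: "z @ [u] \<in> Zplus (Suc n) \<longleftrightarrow> z \<in> Zplus n"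
  by (simp add: Zplus_def)

lemma \<phi>_snoc: "z \<in> Zplus n \<Longrightarrow> i < Suc n \<Longrightarrow> \<phi> i (z @ [u]) = \<psi> i z"
  by (simp add: dep) (simp add: Zplus_def)

lemma Zplus_snocE:
  assumes "x \<in> Zplus (Suc n)"
  obtains z u where "x = z @ [u]" "z \<in> Zplus n" "take n x = z" "x ! n = u"
proof
  show "x = take n x @ [x ! n]"
    using assms by (simp add: Zplus_def take_Suc_conv_app_nth[symmetric])
  show "take n x \<in> Zplus n" using assms by (simp add: Zplus_def)
qed simp_all

lemma \<psi>_bounds: "z \<in> Zplus n \<Longrightarrow> i < Suc n \<Longrightarrow> 0 \<le> \<psi> i z \<and> \<psi> i z \<le> B"
  using full.death_nonneg[of i "z @ [0]"] full.death_le[of i "z @ [0]"] by (simp add: \<phi>_snoc)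

text \<open>Both chains are uniformized at the same rate \<open>c\<close>. Jumps of the last class
  become idle steps of the projected chain, so the two chains can be compared step by step.\<close>

sublocale base: bd_rates n b \<psi> B c
proof
  show "sum (\<lambda>i. b i + B) {..<n} \<le> c"
    using full.rates_le full.birth_pos[of n] full.B_nonneg[of n] by simp
qed (use \<psi>_bounds full.birth_pos full.c_pos in auto)

lemma gen_snoc:
  assumes "z \<in> Zplus n"
  shows "full.gen f (z @ [u]) = base.gen (\<lambda>z. f (z @ [u])) z +
    b n * (f (z @ [u + 1]) - f (z @ [u])) +
    (if u > 0 then \<psi> n z * (f (z @ [u - 1]) - f (z @ [u])) else 0)"
  using assms by (intro bd_gen_snoc) (simp_all add: Zplus_def[of n] \<phi>_snoc)

lemma step_base:
  assumes "x \<in> Zplus (Suc n)"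
  shows "full.step (\<lambda>x. f (take n x)) x = base.step f (take n x)"
proof -
  obtain z u where x: "x = z @ [u]" "z \<in> Zplus n" using assms by (rule Zplus_snocE)
  have "base.gen (\<lambda>z'. f (take n (z' @ [u]))) z = base.gen f z"
    using x by (intro bd_gen_cong) (auto simp: Zplus_def)
  moreover have "length z = n" using x by (simp add: Zplus_def)
  ultimately show ?thesis
    using x by (simp add: full.step_def base.step_def gen_snoc)
qed

lemma nohit_base:
  "x \<in> Zplus (Suc n) \<Longrightarrow> full.nohit {x. take n x \<in> A} m x = base.nohit A m (take n x)"
proof (induction m arbitrary: x)
  case (Suc m)
  have "full.step (full.nohit {x. take n x \<in> A} m) x = full.step (\<lambda>x. base.nohit A m (take n x)) x"
    using Suc by (intro full.step_cong) auto
  then show ?case using Suc.prems by (simp add: step_base)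
qed simp

lemma avoid_base:
  "x \<in> Zplus (Suc n) \<Longrightarrow> full.avoid {x. take n x \<in> A} x = base.avoid A (take n x)"
  by (simp add: full.avoid_def base.avoid_def nohit_base)

section \<open>Escape upwards in the last coordinate\<close>

abbreviation "low k \<equiv> {x. x ! n \<le> k}"

lemma nth_snoc [simp]: "z \<in> Zplus n \<Longrightarrow> (z @ [u]) ! n = u"
  by (simp add: Zplus_def nth_append)

text \<open>The rates do not depend on the level, so the chain started one level higher is a shifted
  copy of the lower one until the latter enters \<open>low k\<close>.\<close>

lemma nohit_low_mono_step:
  "z \<in> Zplus n \<Longrightarrow> full.nohit (low k) m (z @ [u]) \<le> full.nohit (low k) m (z @ [Suc u])"
proof (induction m arbitrary: z u)
  case (Suc m)
  let ?f = "full.nohit (low k) m"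
  let ?g = "\<lambda>x. ?f (x[n := x ! n + 1])"
  have g: "?g (z @ [u]) = ?f (z @ [Suc u])" if "z \<in> Zplus n" for z u
    using that by (simp add: Zplus_def nth_append list_update_append)
  show ?case
  proof (cases "u \<le> k")
    case True
    then show ?thesis using Suc.prems full.nohit_bounds[of "z @ [Suc u]" "low k" "Suc m"]
      by (simp del: full.nohit.simps(2))
  next
    case False
    have "full.step ?f (z @ [u]) \<le> full.step ?g (z @ [u])"
    proof (rule full.step_mono)
      fix x assume "x \<in> Zplus (Suc n)"
      then obtain z u where x: "x = z @ [u]" "z \<in> Zplus n" by (rule Zplus_snocE)
      then show "?f x \<le> ?g x" using Suc.IH[OF x(2), of u] g[OF x(2), of u] by simp
    qed (simp add: Suc.prems)
    \<comment> \<open>The shift commutes with the generator here: \<open>u > k\<close> gives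
      \<open>u > 0\<close>, so the death term is switched on at both \<open>u\<close> and
      \<open>Suc u\<close>.\<close>
    also have "base.gen (\<lambda>z. ?g (z @ [u])) z = base.gen (\<lambda>z. ?f (z @ [Suc u])) z"
      using g Suc.prems by (intro bd_gen_cong) auto
    then have "full.step ?g (z @ [u]) = full.step ?f (z @ [Suc u])"
      using False g[OF Suc.prems, of u] g[OF Suc.prems, of "Suc u"] g[OF Suc.prems, of "u - 1"]
      unfolding full.step_def gen_snoc[OF Suc.prems] by simp
    finally show ?thesis using False Suc.prems by simp
  qed
qed simp

lemma avoid_low_mono:
  assumes "z \<in> Zplus n" "u \<le> v"
  shows "full.avoid (low k) (z @ [u]) \<le> full.avoid (low k) (z @ [v])"
proof -
  have "full.nohit (low k) m (z @ [u]) \<le> full.nohit (low k) m (z @ [v])" for m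
    using lift_Suc_mono_le[of "\<lambda>u. full.nohit (low k) m (z @ [u])", OF _ assms(2)]
      nohit_low_mono_step[OF assms(1)] by simp
  then show ?thesis
    using assms by (intro LIMSEQ_le[OF full.nohit_tendsto full.nohit_tendsto]) auto
qed

text \<open>The last coordinate falls by at most one per step, so level \<open>k\<close> is out of
  reach within \<open>m\<close> steps.\<close>

lemma nohit_low_far: "z \<in> Zplus n \<Longrightarrow> k + m < u \<Longrightarrow> full.nohit (low k) m (z @ [u]) = 1"
proof (induction m arbitrary: z u)
  case (Suc m)
  have "base.gen (\<lambda>z. full.nohit (low k) m (z @ [u])) z = base.gen (\<lambda>_. 1) z"
    using Suc by (intro bd_gen_cong) auto
  moreover have "full.nohit (low k) m (z @ [v]) = 1" if "v \<in> {u - 1, u, u + 1}" for v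
    using Suc that by (intro Suc.IH) auto
  ultimately have "full.gen (full.nohit (low k) m) (z @ [u]) = 0"
    unfolding gen_snoc[OF Suc.prems(1)] using Suc.prems by simp
  then have "full.step (full.nohit (low k) m) (z @ [u]) = 1"
    using Suc by (simp add: full.step_def)
  then show ?case using Suc.prems by simp
qed simp

text \<open>Summing \<open>gen (nohit m) \<le> 0\<close> over the levels above \<open>k\<close>: the vertical part telescopes.\<close>

lemma nohit_low_sum:
  assumes z: "z \<in> Zplus n"
  shows "(\<Sum>u=Suc k..Suc k + m. base.gen (\<lambda>z. full.nohit (low k) m (z @ [u])) z) +
    b n * (1 - full.nohit (low k) m (z @ [Suc k])) \<le> \<psi> n z"
proof -
  define f where "f = full.nohit (low k) m"
  define g where "g u = f (z @ [u])" for u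
  have "base.gen (\<lambda>z. f (z @ [u])) z + b n * (g (Suc u) - g u) - \<psi> n z * (g u - g (u - 1)) \<le> 0"
    if "u \<in> {Suc k..Suc k + m}" for u
  proof -
    have "full.step f (z @ [u]) \<le> f (z @ [u])"
      using full.nohit_Suc_le[of "z @ [u]" "low k" m] z that by (simp add: f_def)
    then have "full.gen f (z @ [u]) \<le> 0"
      using full.c_pos by (simp add: full.step_def divide_le_0_iff)
    then show ?thesis using that unfolding gen_snoc[OF z] g_def by (simp add: algebra_simps)
  qed
  then have "(\<Sum>u=Suc k..Suc k + m. base.gen (\<lambda>z. f (z @ [u])) z + b n * (g (Suc u) - g u)
      - \<psi> n z * (g u - g (u - 1))) \<le> 0"
    by (rule sum_nonpos)
  then have "(\<Sum>u=Suc k..Suc k + m. base.gen (\<lambda>z. f (z @ [u])) z) +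
      b n * (\<Sum>u=Suc k..Suc k + m. g (Suc u) - g u) -
      \<psi> n z * (\<Sum>u=Suc k..Suc k + m. g u - g (u - 1)) \<le> 0"
    by (simp only: sum.distrib sum_subtractf[of "\<lambda>u. _ u + _ u"] sum_distrib_left)
  moreover have "(\<Sum>u=Suc k..Suc k + m. g (Suc u) - g u) = g (Suc (Suc k + m)) - g (Suc k)"
    by (rule sum_Suc_diff) simp
  moreover have "(\<Sum>u=Suc k..Suc k + m. g u - g (u - 1)) = g (Suc k + m) - g k"
    by (induction m) auto
  \<comment> \<open>The range has \<open>m + 1\<close> levels so that its top is beyond the reach of
    \<open>m\<close> steps: both telescoping sums end at the value 1, and the second starts at
    \<open>g k = 0\<close>.\<close>
  moreover have "g (Suc (Suc k + m)) = 1" "g (Suc k + m) = 1" "g k = 0"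
    using z by (auto simp: g_def f_def intro!: nohit_low_far)
  ultimately show ?thesis
    by (simp only: f_def[symmetric] g_def[symmetric]) simp
qed

text \<open>
  A bounded harmonic function dominated by the hitting probability \<open>h\<close> of \<open>low k\<close> satisfies
  \<open>v \<le> sup v \<cdot> h\<close>; by recurrence of \<open>z\<close> the line over \<open>z\<close> already yields its supremum, and there
  \<open>h\<close> stays away from \<open>1\<close>.
\<close>

lemma bounded_harmonic_zero:
  assumes z: "z \<in> Zplus n" and rec: "\<And>y. y \<in> Zplus n \<Longrightarrow> base.avoid {z} y = 0"
    and escape: "0 < full.avoid (low k) (z @ [Suc k])"
    and harm: "\<And>x. x \<in> Zplus (Suc n) \<Longrightarrow> full.gen v x = 0"
    and nonneg: "\<And>x. x \<in> Zplus (Suc n) \<Longrightarrow> 0 \<le> v x"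
    and le: "\<And>x. x \<in> Zplus (Suc n) \<Longrightarrow> v x \<le> 1 - full.avoid (low k) x"
    and x: "x \<in> Zplus (Suc n)"
  shows "v x = 0"
proof -
  define \<delta> where "\<delta> = full.avoid (low k) (z @ [Suc k])"
  define \<rho> where "\<rho> = (SUP x\<in>Zplus (Suc n). v x)"
  have le1: "v x \<le> 1" if "x \<in> Zplus (Suc n)" for x
    using le[OF that] full.avoid_bounds[OF that, of "low k"] by simp
  then have bdd: "bdd_above (v ` Zplus (Suc n))" by (auto intro!: bdd_aboveI)
  have le\<rho>: "v x \<le> \<rho>" if "x \<in> Zplus (Suc n)" for x
    unfolding \<rho>_def using bdd that by (rule cSUP_upper2) simp
  have \<rho>0: "0 \<le> \<rho>" using le\<rho>[OF x] nonneg[OF x] by simp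
  \<comment> \<open>Adding \<open>full.avoid (low k)\<close> turns domination by the hitting
    probability into the constant bound 1, and the sum stays harmonic off \<open>low k\<close>.
    Hence \<open>a = \<rho>\<close> and \<open>d = 1 - \<rho>\<close> in the stopping
    argument.\<close>
  have hit: "v x \<le> \<rho> * (1 - full.avoid (low k) x)" if x: "x \<in> Zplus (Suc n)" for x
  proof -
    have "v x + full.avoid (low k) x \<le> \<rho> + (1 - \<rho>) * full.avoid (low k) x"
    proof (rule full.optional_stopping[where A = "low k"])
      fix x assume "x \<in> Zplus (Suc n)" "x \<notin> low k"
      then show "v x + full.avoid (low k) x \<le> full.step (\<lambda>x. v x + full.avoid (low k) x) x"
        using harm by (simp add: full.step_add full.avoid_step) (simp add: full.step_def)
    next
      fix x assume "x \<in> Zplus (Suc n)" "x \<in> low k"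
      then show "v x + full.avoid (low k) x \<le> \<rho>" using le\<rho> by (simp add: full.avoid_in)
    next
      fix x assume "x \<in> Zplus (Suc n)"
      then show "v x + full.avoid (low k) x \<le> \<rho> + (1 - \<rho>)" using le by fastforce
    qed (rule x)
    then show ?thesis by (simp add: algebra_simps)
  qed
  obtain \<beta> where \<beta>: "0 < \<beta>" "\<beta> \<le> 1" "\<And>i. i < Suc n \<Longrightarrow> \<beta> \<le> b i / c"
    using full.birth_lower_bound by metis
  \<comment> \<open>From any level on the line over \<open>z\<close>, at most \<open>Suc k\<close>
    births lead above level \<open>k\<close>, where the escape probability is at least
    \<delta>.\<close>
  define a where "a = \<rho> * (1 - \<beta> ^ Suc k * \<delta>)"
  have \<delta>: "0 < \<delta>" using escape by (simp add: \<delta>_def)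
  have high: "v (z @ [u]) \<le> \<rho> * (1 - \<delta>)" if "Suc k \<le> u" for u
  proof -
    have "\<rho> * (1 - full.avoid (low k) (z @ [u])) \<le> \<rho> * (1 - \<delta>)"
      using avoid_low_mono[OF z that, of k] \<rho>0 by (intro mult_left_mono) (auto simp: \<delta>_def)
    then show ?thesis using hit[of "z @ [u]"] z by simp
  qed
  have climb: "\<beta> ^ j * (\<rho> * \<delta>) \<le> \<rho> - v (z @ [u])" if "Suc k \<le> u + j" for u j
    using that
  proof (induction j arbitrary: u)
    case 0
    then show ?case using high[of u] by (simp add: algebra_simps)
  next
    case (Suc j)
    have "\<beta> ^ Suc j * (\<rho> * \<delta>) \<le> \<beta> * (\<rho> - v (z @ [Suc u]))"
      using Suc.IH[of "Suc u"] Suc.prems \<beta> by simp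
    also have "\<dots> \<le> b n / c * (\<rho> - v (z @ [Suc u]))"
      using \<beta>(3)[of n] le\<rho>[of "z @ [Suc u]"] z by (intro mult_right_mono) auto
    also have "\<dots> \<le> \<rho> - v (z @ [u])"
      using full.harmonic_birth[of v \<rho> "z @ [u]" n] le\<rho> harm z
      by (simp add: list_update_append Zplus_def)
    finally show ?case .
  qed
  have line: "v (z @ [u]) \<le> a" for u
    using climb[of u "Suc k"] by (simp add: a_def algebra_simps)
  have "v x \<le> a" if x: "x \<in> Zplus (Suc n)" for x
  proof -
    \<comment> \<open>Stopping on the line over \<open>z\<close> bounds \<open>v\<close> by
      \<open>a\<close> up to a multiple of the probability of never reaching that line, which is
      zero by recurrence of \<open>z\<close>.\<close>
    have "v x \<le> a + (\<rho> - a) * full.avoid {x. take n x \<in> {z}} x"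
    proof (rule full.optional_stopping)
      fix x assume "x \<in> Zplus (Suc n)" "x \<in> {x. take n x \<in> {z}}"
      then show "v x \<le> a" using line by (auto elim!: Zplus_snocE)
    qed (use le\<rho> harm x in \<open>auto simp: full.step_def\<close>)
    moreover have "take n x \<in> Zplus n" using x by (simp add: Zplus_def)
    ultimately show ?thesis using rec x by (simp only: avoid_base)
  qed
  then have "\<rho> \<le> a" using x unfolding \<rho>_def by (intro cSUP_least) auto
  then have "\<rho> * (\<beta> ^ Suc k * \<delta>) \<le> 0"
    by (simp only: a_def right_diff_distrib mult_1_right)
  moreover have "0 < \<beta> ^ Suc k * \<delta>" using \<beta> \<delta> by simp
  ultimately have "\<rho> \<le> 0" by (meson mult_pos_pos not_le)
  then have "\<rho> = 0" using \<rho>0 by simp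
  then show ?thesis using le\<rho>[OF x] nonneg[OF x] by simp
qed

end

section \<open>Expectations under probability mass functions\<close>

lemma integrable_pmf_bounded:
  fixes f :: "'a \<Rightarrow> real"
  assumes "\<And>x. x \<in> set_pmf p \<Longrightarrow> \<bar>f x\<bar> \<le> C"
  shows "integrable (measure_pmf p) f"
  using assms by (intro measure_pmf.integrable_const_bound[where B = C]) (auto simp: AE_measure_pmf_iff)

lemma pmf_expectation_mono:
  fixes f g :: "'a \<Rightarrow> real"
  assumes "\<And>x. x \<in> set_pmf p \<Longrightarrow> \<bar>f x\<bar> \<le> C" "\<And>x. x \<in> set_pmf p \<Longrightarrow> \<bar>g x\<bar> \<le> D"
    and "\<And>x. x \<in> set_pmf p \<Longrightarrow> f x \<le> g x"
  shows "measure_pmf.expectation p f \<le> measure_pmf.expectation p g"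
  using assms by (intro integral_mono_AE integrable_pmf_bounded) (auto simp: AE_measure_pmf_iff)

lemma pmf_expectation_cong:
  fixes f g :: "'a \<Rightarrow> real"
  assumes "\<And>x. x \<in> set_pmf p \<Longrightarrow> f x = g x"
  shows "measure_pmf.expectation p f = measure_pmf.expectation p g"
  using assms by (intro integral_cong_AE) (auto simp: AE_measure_pmf_iff)

lemma pmf_expectation_abs_le:
  fixes f :: "'a \<Rightarrow> real"
  assumes "\<And>x. x \<in> set_pmf p \<Longrightarrow> \<bar>f x\<bar> \<le> C"
  shows "\<bar>measure_pmf.expectation p f\<bar> \<le> C"
  using pmf_expectation_mono[of p f C "\<lambda>_. C" "\<bar>C\<bar>"] pmf_expectation_mono[of p "\<lambda>_. -C" "\<bar>C\<bar>" f C] assms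
  by (auto simp: abs_le_iff) (smt (verit) assms)

lemma pmf_expectation_bind_bounded:
  fixes h :: "'b \<Rightarrow> real"
  assumes "\<And>y. y \<in> set_pmf (bind_pmf p f) \<Longrightarrow> \<bar>h y\<bar> \<le> C"
  shows "measure_pmf.expectation (bind_pmf p f) h =
    measure_pmf.expectation p (\<lambda>x. measure_pmf.expectation (f x) h)"
proof -
  \<comment> \<open>\<open>h\<close> is controlled only on the support of the compound law; setting
    it to 0 elsewhere makes it bounded everywhere without changing the expectations.\<close>
  define g where "g y = (if y \<in> set_pmf (bind_pmf p f) then h y else 0)" for y
  have "measure_pmf.expectation (bind_pmf p f) h = measure_pmf.expectation (bind_pmf p f) g"
    by (rule pmf_expectation_cong) (simp add: g_def)
  also have "\<dots> = measure_pmf.expectation p (\<lambda>x. measure_pmf.expectation (f x) g)"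
    unfolding measure_pmf_bind
    by (rule integral_bind[where K = "count_space UNIV" and B' = 1 and B = "\<bar>C\<bar>"])
      (use assms measurable_measure_pmf[of f] in \<open>auto simp: g_def measure_pmf.emeasure_eq_measure
        intro: measure_pmf.finite_measure_axioms order_trans[OF _ abs_ge_self]\<close>)
  also have "\<dots> = measure_pmf.expectation p (\<lambda>x. measure_pmf.expectation (f x) h)"
    by (intro pmf_expectation_cong) (auto simp: g_def)
  finally show ?thesis .
qed

lemma pmf_expectation_tendsto:
  fixes f :: "nat \<Rightarrow> 'a \<Rightarrow> real"
  assumes "\<And>m x. x \<in> set_pmf p \<Longrightarrow> \<bar>f m x\<bar> \<le> C"
    and "\<And>x. x \<in> set_pmf p \<Longrightarrow> (\<lambda>m. f m x) \<longlonglongrightarrow> g x"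
  shows "(\<lambda>m. measure_pmf.expectation p (f m)) \<longlonglongrightarrow> measure_pmf.expectation p g"
  using assms
  by (intro integral_dominated_convergence[where w = "\<lambda>_. C"]) (auto simp: AE_measure_pmf_iff)

text \<open>The one-sided limit is tested along sequences, to each of which dominated convergence
  applies.\<close>

lemma pmf_expectation_tendsto_at_right:
  fixes f :: "real \<Rightarrow> 'a \<Rightarrow> real"
  assumes bound: "\<And>h x. 0 < h \<Longrightarrow> x \<in> set_pmf p \<Longrightarrow> \<bar>f h x\<bar> \<le> C"
    and lim: "\<And>x. x \<in> set_pmf p \<Longrightarrow> ((\<lambda>h. f h x) \<longlongrightarrow> g x) (at_right 0)"
  shows "((\<lambda>h. measure_pmf.expectation p (f h)) \<longlongrightarrow> measure_pmf.expectation p g) (at_right 0)"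
  unfolding tendsto_at_iff_sequentially comp_def
proof (intro allI impI)
  fix X :: "nat \<Rightarrow> real" assume X: "\<forall>i. X i \<in> {0<..} - {0}" "X \<longlonglongrightarrow> 0"
  show "(\<lambda>i. measure_pmf.expectation p (f (X i))) \<longlonglongrightarrow> measure_pmf.expectation p g"
  proof (rule pmf_expectation_tendsto)
    show "\<bar>f (X m) x\<bar> \<le> C" if "x \<in> set_pmf p" for m x using bound that X by auto
    show "(\<lambda>m. f (X m) x) \<longlonglongrightarrow> g x" if "x \<in> set_pmf p" for x
      using lim[OF that] X unfolding tendsto_at_iff_sequentially comp_def by blast
  qed
qed

lemma infsum_pmf_eq_expectation:
  fixes g :: "'a \<Rightarrow> real"
  assumes "set_pmf p \<subseteq> A" and g: "\<And>x. x \<in> A \<Longrightarrow> \<bar>g x\<bar> \<le> C"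
  shows "(\<Sum>\<^sub>\<infinity>x\<in>A. g x * pmf p x) = measure_pmf.expectation p g"
proof -
  let ?g = "\<lambda>x. if x \<in> A then g x else 0"
  have "measure_pmf.expectation p g = measure_pmf.expectation p ?g"
    using assms by (intro pmf_expectation_cong) auto
  also have "\<dots> = infsetsum (\<lambda>x. pmf p x * ?g x) UNIV"
    by (rule pmf_expectation_eq_infsetsum)
  also have "\<dots> = infsum (\<lambda>x. pmf p x * ?g x) UNIV"
  proof (rule infsetsum_infsum, rule Infinite_Set_Sum.abs_summable_on_comparison_test)
    show "Infinite_Set_Sum.abs_summable_on (\<lambda>x. \<bar>C\<bar> * pmf p x) UNIV"
      by (intro Infinite_Set_Sum.abs_summable_on_cmult_right pmf_abs_summable)
    show "norm (pmf p x * ?g x) \<le> norm (\<bar>C\<bar> * pmf p x)" for x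
      using g[of x] by (auto simp: abs_mult mult.commute[of "pmf p x"] intro!: mult_right_mono)
  qed
  also have "\<dots> = (\<Sum>\<^sub>\<infinity>x\<in>A. g x * pmf p x)"
    by (rule infsum_cong_neutral) auto
  finally show ?thesis ..
qed

section \<open>Semigroups with bounded rates\<close>

locale bd_semigroup = bd_rates +
  fixes P :: "real \<Rightarrow> nat list \<Rightarrow> nat list pmf"
  assumes transition: "transition_function (Zplus N) P"
    and transition_rates: "has_transition_rates (Zplus N) P (bd_rate N b \<phi>)"
begin

abbreviation expect :: "real \<Rightarrow> (nat list \<Rightarrow> real) \<Rightarrow> nat list \<Rightarrow> real" where
  "expect t f x \<equiv> measure_pmf.expectation (P t x) f"

lemma set_P: "0 \<le> t \<Longrightarrow> x \<in> Zplus N \<Longrightarrow> y \<in> set_pmf (P t x) \<Longrightarrow> y \<in> Zplus N"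
  using transition by (auto simp: transition_function_def)

lemma P_0: "x \<in> Zplus N \<Longrightarrow> P 0 x = return_pmf x"
  using transition by (auto simp: transition_function_def)

lemma P_add: "0 \<le> s \<Longrightarrow> 0 \<le> t \<Longrightarrow> x \<in> Zplus N \<Longrightarrow> P (s + t) x = bind_pmf (P s x) (P t)"
  using transition by (auto simp: transition_function_def)

lemma expect_abs_le:
  assumes "\<And>y. y \<in> Zplus N \<Longrightarrow> \<bar>f y\<bar> \<le> C" "0 \<le> t" "x \<in> Zplus N"
  shows "\<bar>expect t f x\<bar> \<le> C"
  using assms set_P by (intro pmf_expectation_abs_le) auto

lemma expect_add:
  assumes "\<And>y. y \<in> Zplus N \<Longrightarrow> \<bar>f y\<bar> \<le> C" "0 \<le> s" "0 \<le> t" "x \<in> Zplus N"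
  shows "expect (s + t) f x = expect s (expect t f) x"
  unfolding P_add[OF assms(2-4)]
proof (rule pmf_expectation_bind_bounded)
  fix y assume "y \<in> set_pmf (bind_pmf (P s x) (P t))"
  then have "y \<in> set_pmf (P (s + t) x)" using P_add[OF assms(2-4)] by simp
  then have "y \<in> Zplus N" by (rule set_P[rotated 2]) (use assms in auto)
  then show "\<bar>f y\<bar> \<le> C" by (rule assms)
qed

section \<open>The generator as derivative of the semigroup at time 0\<close>

definition "neighbours x =
  (\<lambda>i. x[i := x ! i + 1]) ` {..<N} \<union> (\<lambda>i. x[i := x ! i - 1]) ` {i. i < N \<and> x ! i > 0}"

lemma finite_neighbours [simp]: "finite (neighbours x)"
  by (simp add: neighbours_def)

lemma neighbours_subset: "x \<in> Zplus N \<Longrightarrow> neighbours x \<subseteq> Zplus N - {x}"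
  by (auto simp: neighbours_def Zplus_def list_eq_iff_nth_eq)
    (metis nth_list_update_eq n_not_Suc_n Suc_pred nth_list_update)+

lemma bd_rate_eq_0: "y \<notin> neighbours x \<Longrightarrow> bd_rate N b \<phi> x y = 0"
  unfolding bd_rate_def neighbours_def by (intro sum.neutral) auto

lemma sum_bd_rate:
  "(\<Sum>y\<in>neighbours x. bd_rate N b \<phi> x y * g y) =
    (\<Sum>i<N. b i * g (x[i := x ! i + 1]) + (if x ! i > 0 then \<phi> i x * g (x[i := x ! i - 1]) else 0))"
proof -
  have "(\<Sum>y\<in>neighbours x. bd_rate N b \<phi> x y * g y) =
    (\<Sum>i<N. \<Sum>y\<in>neighbours x. (if y = x[i := x ! i + 1] then b i * g y else 0) +
      (if y = x[i := x ! i - 1] then if x ! i > 0 then \<phi> i x * g y else 0 else 0))"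
    unfolding bd_rate_def sum_distrib_right
    by (subst sum.swap, intro sum.cong refl) (simp add: distrib_right)
  also have "\<dots> = (\<Sum>i<N. b i * g (x[i := x ! i + 1]) +
      (if x ! i > 0 then \<phi> i x * g (x[i := x ! i - 1]) else 0))"
    by (intro sum.cong) (auto simp: sum.distrib sum.delta' neighbours_def)
  finally show ?thesis .
qed

lemma sum_bd_rate_neighbours: "(\<Sum>y\<in>neighbours x. bd_rate N b \<phi> x y) = total_rate x"
  using sum_bd_rate[of x "\<lambda>_. 1"] by (simp add: total_rate_def cong: if_cong)

lemma infsum_bd_rate:
  assumes x: "x \<in> Zplus N"
  shows "(\<Sum>\<^sub>\<infinity>y\<in>Zplus N - {x}. bd_rate N b \<phi> x y) = total_rate x"
proof -
  have "(\<Sum>\<^sub>\<infinity>y\<in>Zplus N - {x}. bd_rate N b \<phi> x y) = (\<Sum>\<^sub>\<infinity>y\<in>neighbours x. bd_rate N b \<phi> x y)"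
    using neighbours_subset[OF x] by (intro infsum_cong_neutral) (auto simp: bd_rate_eq_0)
  then show ?thesis by (simp add: sum_bd_rate_neighbours)
qed

lemma gen_eq: "gen f x = (\<Sum>y\<in>neighbours x. bd_rate N b \<phi> x y * (f y - f x))"
  by (simp add: sum_bd_rate bd_gen_def)

lemma leave_rate:
  "x \<in> Zplus N \<Longrightarrow> ((\<lambda>h. (1 - pmf (P h x) x) / h) \<longlongrightarrow> total_rate x) (at_right 0)"
  using transition_rates by (simp add: has_transition_rates_def infsum_bd_rate)

lemma jump_rate:
  assumes "x \<in> Zplus N" "y \<in> neighbours x"
  shows "((\<lambda>h. pmf (P h x) y / h) \<longlongrightarrow> bd_rate N b \<phi> x y) (at_right 0)"
proof -
  have "y \<in> Zplus N" "x \<noteq> y" using neighbours_subset[OF assms(1)] assms by auto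
  then show ?thesis using transition_rates assms by (simp add: has_transition_rates_def)
qed

text \<open>Among the ways of being at \<open>x\<close> at time \<open>s + t\<close>, only those
  that are at \<open>x\<close> at time \<open>s\<close> are counted.\<close>

lemma pmf_P_add_ge:
  assumes "0 \<le> s" "0 \<le> t" "x \<in> Zplus N"
  shows "pmf (P s x) x * pmf (P t x) x \<le> pmf (P (s + t) x) x"
proof -
  have "pmf (P s x) x * pmf (P t x) x = measure_pmf.expectation (P s x) (\<lambda>y. indicator {x} y * pmf (P t x) x)"
    by (simp add: measure_pmf_single)
  also have "\<dots> \<le> measure_pmf.expectation (P s x) (\<lambda>y. pmf (P t y) x)"
    by (intro pmf_expectation_mono[where C = 1 and D = 1]) (auto simp: pmf_le_1 indicator_def)
  finally show ?thesis using assms by (simp add: P_add pmf_bind)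
qed

text \<open>\<open>1 - p_t(x,x)\<close> is subadditive in \<open>t\<close>, so its slope at \<open>0\<close> bounds it globally.\<close>

lemma leave_prob_le:
  assumes h: "0 \<le> h" and x: "x \<in> Zplus N"
  shows "1 - pmf (P h x) x \<le> total_rate x * h"
proof (cases "h = 0")
  case False
  define a where "a t = 1 - pmf (P t x) x" for t
  have add: "a (s + t) \<le> a s + a t" if "0 \<le> s" "0 \<le> t" for s t
  proof -
    have "0 \<le> a s * a t" by (simp add: a_def pmf_le_1)
    then show ?thesis using pmf_P_add_ge[OF that x] by (simp add: a_def algebra_simps)
  qed
  have mult: "a (real m * t) \<le> real m * a t" if "0 \<le> t" for m t
  proof (induction m)
    case 0
    then show ?case using x by (simp add: a_def P_0)
  next
    case (Suc m)
    then show ?case using add[of "real m * t" t] that by (simp add: algebra_simps)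
  qed
  have "((\<lambda>t. a t / t) \<longlongrightarrow> total_rate x) (at_right 0)"
    using leave_rate[OF x] by (simp add: a_def)
  \<comment> \<open>The time \<open>h\<close> is cut into \<open>m + 1\<close> equal pieces: by
    \<open>mult\<close>, the slope at \<open>h\<close> is at most the slope at one piece, which
    tends to the total rate.\<close>
  moreover have "filterlim (\<lambda>m. h / real (Suc m)) (at_right 0) sequentially"
    unfolding filterlim_at using h False LIMSEQ_Suc[OF lim_const_over_n[of h]] by auto
  ultimately have "(\<lambda>m. a (h / real (Suc m)) / (h / real (Suc m))) \<longlonglongrightarrow> total_rate x"
    by (rule filterlim_compose)
  moreover have "a h / h \<le> a (h / real (Suc m)) / (h / real (Suc m))" for m
  proof -
    have "real (Suc m) * (h / real (Suc m)) = h" by (simp del: of_nat_Suc)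
    then have "a h \<le> real (Suc m) * a (h / real (Suc m))"
      using mult[of "h / real (Suc m)" "Suc m"] h by simp
    then have "a h / h \<le> real (Suc m) * a (h / real (Suc m)) / h"
      using h by (rule divide_right_mono)
    then show ?thesis by (simp add: ac_simps)
  qed
  ultimately have "a h / h \<le> total_rate x" by (intro LIMSEQ_le_const) auto
  then show ?thesis using h False by (simp add: a_def field_simps)
qed (simp add: P_0 x)

text \<open>The difference \<open>f y - f x\<close> vanishes at \<open>y = x\<close> and is at most
  \<open>2 * C\<close> in absolute value elsewhere, where the mass is at most
  \<open>c * h\<close>.\<close>

lemma expect_diff_le:
  assumes f: "\<And>y. y \<in> Zplus N \<Longrightarrow> \<bar>f y\<bar> \<le> C" and h: "0 \<le> h" and x: "x \<in> Zplus N"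
  shows "\<bar>expect h f x - f x\<bar> \<le> 2 * C * c * h"
proof -
  have C: "0 \<le> C" using f[OF x] by simp
  have int: "integrable (P h x) f" using f set_P[OF h x] by (intro integrable_pmf_bounded[where C = C]) auto
  have "\<bar>expect h f x - f x\<bar> = \<bar>expect h (\<lambda>y. f y - f x) x\<bar>"
    using int by simp
  also have "\<dots> \<le> expect h (\<lambda>y. \<bar>f y - f x\<bar>) x" by (rule integral_abs_bound)
  also have "\<dots> \<le> expect h (\<lambda>y. 2 * C * (1 - indicator {x} y)) x"
  proof (rule pmf_expectation_mono[where C = "2 * C" and D = "2 * C"])
    fix y assume "y \<in> set_pmf (P h x)"
    then have "\<bar>f y\<bar> \<le> C" using f set_P[OF h x] by auto
    then show "\<bar>\<bar>f y - f x\<bar>\<bar> \<le> 2 * C" "\<bar>f y - f x\<bar> \<le> 2 * C * (1 - indicator {x} y)"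
      using f[OF x] by (auto simp: indicator_def)
  qed (use C in \<open>auto simp: indicator_def\<close>)
  also have "\<dots> = 2 * C * (1 - pmf (P h x) x)"
    by (subst integral_mult_right_zero, subst Bochner_Integration.integral_diff)
      (auto intro: integrable_pmf_bounded[where C = 1] simp: measure_pmf_single)
  also have "\<dots> \<le> 2 * C * (c * h)"
    using order_trans[OF leave_prob_le[OF h x] mult_right_mono[OF total_rate_le[OF x] h]] C
    by (intro mult_left_mono) auto
  finally show ?thesis by simp
qed

lemma expect_deriv:
  assumes f: "\<And>y. y \<in> Zplus N \<Longrightarrow> \<bar>f y\<bar> \<le> C" and x: "x \<in> Zplus N"
  shows "((\<lambda>h. (expect h f x - f x) / h) \<longlongrightarrow> gen f x) (at_right 0)"
proof (rule Lim_transform)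
  let ?F = "insert x (neighbours x)"
  let ?s = "\<lambda>h. \<Sum>y\<in>neighbours x. pmf (P h x) y / h * (f y - f x)"
  \<comment> \<open>This is \<open>2 * C / h\<close> times the probability of being neither at
    \<open>x\<close> nor at a neighbour. It tends to 0 because the neighbours exhaust the total
    leaving rate.\<close>
  let ?e = "\<lambda>h. 2 * C * ((1 - pmf (P h x) x) / h - (\<Sum>y\<in>neighbours x. pmf (P h x) y / h))"
  show "(?s \<longlongrightarrow> gen f x) (at_right 0)"
    unfolding gen_eq by (intro tendsto_intros jump_rate x)
  have "(?e \<longlongrightarrow> 2 * C * (total_rate x - (\<Sum>y\<in>neighbours x. bd_rate N b \<phi> x y))) (at_right 0)"
    by (intro tendsto_intros jump_rate leave_rate x)
  then have e: "(?e \<longlongrightarrow> 0) (at_right 0)" by (simp add: sum_bd_rate_neighbours)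
  have xn: "x \<notin> neighbours x" using neighbours_subset[OF x] by auto
  have "\<bar>(expect h f x - f x) / h - ?s h\<bar> \<le> ?e h" if h: "0 < h" for h
  proof -
    have fb: "\<bar>f y\<bar> \<le> C" if "y \<in> set_pmf (P h x)" for y
      using that set_P[of h x y] x h f by auto
    let ?G = "\<lambda>y. f y - f x"
    have int: "integrable (P h x) f" using fb by (rule integrable_pmf_bounded)
    have ind: "integrable (P h x) (indicator A :: _ \<Rightarrow> real)" for A
      by (rule integrable_pmf_bounded[where C = 1]) (auto simp: indicator_def)
    have iG: "integrable (P h x) (\<lambda>y. indicator ?F y * ?G y)"
      using fb f[OF x] by (intro integrable_pmf_bounded[where C = "2 * C"])
        (fastforce simp: indicator_def)
    have "expect h (\<lambda>y. indicator ?F y * ?G y) x = (\<Sum>y\<in>?F. indicator ?F y * ?G y * pmf (P h x) y)"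
      by (rule integral_measure_pmf_real) (auto simp: indicator_def)
    also have "\<dots> = (\<Sum>y\<in>neighbours x. pmf (P h x) y * ?G y)"
      using xn by (auto simp: algebra_simps intro!: sum.cong)
    finally have 1: "expect h (\<lambda>y. indicator ?F y * ?G y) x = (\<Sum>y\<in>neighbours x. pmf (P h x) y * ?G y)" .
    have "\<bar>(expect h f x - f x) - (\<Sum>y\<in>neighbours x. pmf (P h x) y * ?G y)\<bar> =
        \<bar>expect h (\<lambda>y. ?G y - indicator ?F y * ?G y) x\<bar>"
      using int iG by (subst Bochner_Integration.integral_diff) (auto simp: 1)
    also have "\<dots> \<le> expect h (\<lambda>y. \<bar>?G y - indicator ?F y * ?G y\<bar>) x" by (rule integral_abs_bound)
    also have "\<dots> \<le> expect h (\<lambda>y. 2 * C * (1 - indicator ?F y)) x"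
    proof (rule pmf_expectation_mono[where C = "2 * C" and D = "2 * C"])
      fix y assume "y \<in> set_pmf (P h x)"
      then have "\<bar>f y\<bar> \<le> C" by (rule fb)
      then show "\<bar>\<bar>?G y - indicator ?F y * ?G y\<bar>\<bar> \<le> 2 * C"
        "\<bar>?G y - indicator ?F y * ?G y\<bar> \<le> 2 * C * (1 - indicator ?F y)"
        using f[OF x] by (auto simp: indicator_def)
    qed (use f[OF x] in \<open>auto simp: indicator_def\<close>)
    also have "\<dots> = 2 * C * (1 - measure (P h x) ?F)"
      using ind by (subst integral_mult_right_zero, subst Bochner_Integration.integral_diff) auto
    also have "measure (P h x) ?F = pmf (P h x) x + (\<Sum>y\<in>neighbours x. pmf (P h x) y)"
      using xn by (simp add: measure_measure_pmf_finite)
    finally have 2: "\<bar>(expect h f x - f x) - (\<Sum>y\<in>neighbours x. pmf (P h x) y * ?G y)\<bar>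
      \<le> 2 * C * (1 - (pmf (P h x) x + (\<Sum>y\<in>neighbours x. pmf (P h x) y)))" .
    have "?s h = (\<Sum>y\<in>neighbours x. pmf (P h x) y * ?G y) / h"
      by (simp add: sum_divide_distrib)
    then have "\<bar>(expect h f x - f x) / h - ?s h\<bar> =
        \<bar>(expect h f x - f x) - (\<Sum>y\<in>neighbours x. pmf (P h x) y * ?G y)\<bar> / h"
      using h by (simp only: diff_divide_distrib[symmetric] abs_divide abs_of_pos)
    also have "\<dots> \<le> 2 * C * (1 - (pmf (P h x) x + (\<Sum>y\<in>neighbours x. pmf (P h x) y))) / h"
      using 2 h by (intro divide_right_mono) auto
    also have "\<dots> = ?e h"
      by (simp only: sum_divide_distrib[symmetric] diff_divide_distrib[symmetric] diff_diff_eq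
          times_divide_eq_right)
    finally show ?thesis .
  qed
  then have "\<forall>\<^sub>F h in at_right 0. norm ((expect h f x - f x) / h - ?s h) \<le> ?e h"
    by (intro eventually_mono[OF eventually_at_right_less]) simp
  then show "((\<lambda>h. (expect h f x - f x) / h - ?s h) \<longlongrightarrow> 0) (at_right 0)"
    using e by (rule Lim_null_comparison)
qed

lemma expect_0: "x \<in> Zplus N \<Longrightarrow> expect 0 f x = f x"
  by (simp add: P_0)

lemma integrable_P:
  fixes f :: "nat list \<Rightarrow> real"
  shows "(\<And>y. y \<in> Zplus N \<Longrightarrow> \<bar>f y\<bar> \<le> C) \<Longrightarrow> 0 \<le> t \<Longrightarrow> x \<in> Zplus N \<Longrightarrow> integrable (P t x) f"
  by (rule integrable_pmf_bounded[where C = C]) (auto dest: set_P)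

lemma expect_mono:
  assumes "\<And>y. y \<in> Zplus N \<Longrightarrow> \<bar>f y\<bar> \<le> C" "\<And>y. y \<in> Zplus N \<Longrightarrow> \<bar>g y\<bar> \<le> D"
    and "\<And>y. y \<in> Zplus N \<Longrightarrow> f y \<le> g y" "0 \<le> t" "x \<in> Zplus N"
  shows "expect t f x \<le> expect t g x"
  using assms set_P[OF assms(4,5)] by (intro pmf_expectation_mono[where C = C and D = D]) simp_all

text \<open>
  \<open>s \<mapsto> expect s g x\<close> has derivative \<open>expect s (gen g) x \<ge> 0\<close>; the difference quotients
  to the left and right of \<open>s\<close> are compared with those based at \<open>s\<close> itself.
\<close>

lemma subharmonic_imp_expect_ge:
  assumes g: "\<And>y. y \<in> Zplus N \<Longrightarrow> \<bar>g y\<bar> \<le> C" and sub: "\<And>y. y \<in> Zplus N \<Longrightarrow> 0 \<le> gen g y"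
    and t: "0 \<le> t" and x: "x \<in> Zplus N"
  shows "g x \<le> expect t g x"
proof -
  have C: "0 \<le> C" using g[OF x] by simp
  define D where "D h y = expect h g y - g y" for h y
  have D: "\<bar>D h y\<bar> \<le> 2 * C * c * h" if "0 \<le> h" "y \<in> Zplus N" for h y
    unfolding D_def using g that by (rule expect_diff_le)
  have main: "- \<epsilon> * (v - u) \<le> expect v g x - expect u g x" if \<epsilon>: "0 < \<epsilon>" and "0 \<le> u" "u \<le> v" for \<epsilon> u v
  proof -
    \<comment> \<open>The claim is additive over adjacent intervals, so bisection reduces it to
      short intervals around a point \<open>s\<close>. Nonnegativity of the left end is part of the
      claim because that end varies.\<close>
    have "0 \<le> u \<longrightarrow> - \<epsilon> * (v - u) \<le> expect v g x - expect u g x"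
      using \<open>u \<le> v\<close>
    proof (induction rule: Bolzano)
      case (trans a b c)
      then show ?case by (auto simp: algebra_simps)
    next
      case (local s)
      then have s: "0 \<le> s" using \<open>0 \<le> u\<close> by simp
      have "((\<lambda>h. expect s (\<lambda>y. D h y / h) x) \<longlongrightarrow> expect s (gen g) x) (at_right 0)"
      proof (rule pmf_expectation_tendsto_at_right)
        fix h y assume h: "0 < (h::real)" and y: "y \<in> set_pmf (P s x)"
        then show "\<bar>D h y / h\<bar> \<le> 2 * C * c"
          using D[of h y] set_P[OF s x y] by (simp add: field_simps)
      next
        fix y assume y: "y \<in> set_pmf (P s x)"
        then show "((\<lambda>h. D h y / h) \<longlongrightarrow> gen g y) (at_right 0)"
          unfolding D_def using g set_P[OF s x y] by (intro expect_deriv)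
      qed
      moreover have "0 \<le> expect s (gen g) x"
        using sub set_P[OF s x] by (intro integral_nonneg_AE) (auto simp: AE_measure_pmf_iff)
      ultimately have "\<forall>\<^sub>F h in at_right 0. - (\<epsilon> / 2) < expect s (\<lambda>y. D h y / h) x"
        using \<epsilon> by (intro order_tendstoD(1)) auto
      then obtain d where d: "0 < d" "\<And>h. 0 < h \<Longrightarrow> h < d \<Longrightarrow> - (\<epsilon> / 2) < expect s (\<lambda>y. D h y / h) x"
        unfolding eventually_at_right_field by auto
      \<comment> \<open>The second bound keeps the cost \<open>4 * C * c * c * h\<close> of moving
        the base point from \<open>a\<close> to \<open>s\<close> at most
        \<open>\<epsilon> / 2\<close>; the \<open>+ 1\<close> makes the denominator
        positive.\<close>
      define d' where "d' = min d (\<epsilon> / (8 * C * c * c + 1))"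
      have Cc: "0 \<le> 8 * C * c * c" using C c_pos by simp
      have "0 < d'" using d \<epsilon> Cc by (simp add: d'_def add_nonneg_pos)
      moreover have "- \<epsilon> * (b - a) \<le> expect b g x - expect a g x"
        if ab: "0 \<le> a" "a \<le> s" "s \<le> b" "b - a < d'" for a b
      proof (cases "a = b")
        case False
        define h where "h = b - a"
        have h: "0 < h" "h < d" "h * (8 * C * c * c + 1) \<le> \<epsilon>" "s - a \<le> h"
          using ab False \<epsilon> Cc by (auto simp: h_def d'_def field_simps)
        have Dh: "\<And>y. y \<in> Zplus N \<Longrightarrow> \<bar>D h y\<bar> \<le> 2 * C * c * h" using D h by simp
        have "expect (a + h) g x = expect a (expect h g) x"
          using g ab h x by (intro expect_add) auto
        then have 1: "expect b g x - expect a g x = expect a (D h) x"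
          unfolding D_def using ab h x g
          by (subst Bochner_Integration.integral_diff)
            (auto simp: h_def intro!: integrable_P[where C = C] expect_abs_le)
        have 2: "expect s (D h) x = h * expect s (\<lambda>y. D h y / h) x"
          using h by simp
        \<comment> \<open>\<open>D h\<close> itself has size \<open>2 * C * c * h\<close>, so
          transporting it over the time \<open>s - a \<le> h\<close> changes its expectation only to
          second order in \<open>h\<close>.\<close>
        have ea: "expect (a + (s - a)) (D h) x = expect a (expect (s - a) (D h)) x"
          using Dh ab x by (intro expect_add) auto
        have "expect s (D h) x - expect a (D h) x = expect a (\<lambda>y. expect (s - a) (D h) y - D h y) x"
          using ea Dh ab x
          by (subst Bochner_Integration.integral_diff)
            (auto intro!: integrable_P[where C = "2 * C * c * h"] expect_abs_le)
        also have "\<bar>\<dots>\<bar> \<le> 2 * (2 * C * c * h) * c * (s - a)"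
          using Dh ab x by (intro expect_abs_le expect_diff_le) auto
        also have "\<dots> \<le> 2 * (2 * C * c * h) * c * h"
          using h C c_pos by (intro mult_left_mono) auto
        finally have 3: "\<bar>expect s (D h) x - expect a (D h) x\<bar> \<le> h * (4 * C * c * c * h)"
          by (simp add: ac_simps)
        have "h * (4 * C * c * c * h) \<le> h * (\<epsilon> / 2)"
          using h by (intro mult_left_mono) (auto simp: algebra_simps)
        moreover have "h * (- (\<epsilon> / 2)) \<le> expect s (D h) x"
          unfolding 2 using d(2)[of h] h by (intro mult_left_mono) auto
        ultimately show ?thesis using 1 3 by (simp add: h_def[symmetric] algebra_simps)
      qed simp
      ultimately show ?case by auto
    qed
    then show ?thesis using that by simp
  qed
  have "g x \<le> expect t g x + \<epsilon>" if "0 < \<epsilon>" for \<epsilon>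
  proof -
    \<comment> \<open>Dividing by \<open>t + 1\<close> instead of \<open>t\<close> covers
      \<open>t = 0\<close> as well.\<close>
    have "\<epsilon> / (t + 1) * t \<le> \<epsilon>" using that t by (simp add: field_simps)
    then show ?thesis using main[of "\<epsilon> / (t + 1)" 0 t] that t x by (simp add: expect_0)
  qed
  then show ?thesis by (rule field_le_epsilon)
qed

section \<open>Invariant functions and stationary distributions\<close>

lemma invariant_imp_harmonic:
  assumes f: "\<And>y. y \<in> Zplus N \<Longrightarrow> \<bar>f y\<bar> \<le> C" and inv: "\<And>t. 0 \<le> t \<Longrightarrow> expect t f x = f x"
    and x: "x \<in> Zplus N"
  shows "gen f x = 0"
proof (rule tendsto_unique)
  show "((\<lambda>h. (expect h f x - f x) / h) \<longlongrightarrow> gen f x) (at_right 0)"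
    using f x by (rule expect_deriv)
  have "\<forall>\<^sub>F h in at_right 0. (expect h f x - f x) / h = 0"
    by (rule eventually_mono[OF eventually_at_right_less]) (simp add: inv)
  then show "((\<lambda>h. (expect h f x - f x) / h) \<longlongrightarrow> 0) (at_right 0)"
    by (simp add: tendsto_eventually)
qed simp

text \<open>By invariance the difference quotients have \<pi>-mean 0. They are bounded by
  \<open>2 * C * c\<close> uniformly in \<open>h\<close>, so the limit at \<open>h = 0\<close>
  passes under the expectation.\<close>

lemma stationary_gen:
  assumes set: "set_pmf \<pi> \<subseteq> Zplus N" and stat: "\<And>t. 0 \<le> t \<Longrightarrow> bind_pmf \<pi> (P t) = \<pi>"
    and f: "\<And>y. y \<in> Zplus N \<Longrightarrow> \<bar>f y\<bar> \<le> C"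
  shows "measure_pmf.expectation \<pi> (gen f) = 0"
proof (rule tendsto_unique)
  show "((\<lambda>h. measure_pmf.expectation \<pi> (\<lambda>x. (expect h f x - f x) / h)) \<longlongrightarrow>
    measure_pmf.expectation \<pi> (gen f)) (at_right 0)"
  proof (rule pmf_expectation_tendsto_at_right)
    fix h x assume h: "0 < (h::real)" and x: "x \<in> set_pmf \<pi>"
    then show "\<bar>(expect h f x - f x) / h\<bar> \<le> 2 * C * c"
      using expect_diff_le[of f C h x] f set by (auto simp: field_simps)
  next
    fix x assume x: "x \<in> set_pmf \<pi>"
    then show "((\<lambda>h. (expect h f x - f x) / h) \<longlongrightarrow> gen f x) (at_right 0)"
      using f set by (intro expect_deriv) auto
  qed
  have "measure_pmf.expectation \<pi> (\<lambda>x. (expect h f x - f x) / h) = 0" if h: "0 < h" for h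
  proof -
    have "measure_pmf.expectation (bind_pmf \<pi> (P h)) f = measure_pmf.expectation \<pi> (expect h f)"
    proof (rule pmf_expectation_bind_bounded)
      show "\<bar>f y\<bar> \<le> C" if "y \<in> set_pmf (bind_pmf \<pi> (P h))" for y
        using that f set stat[of h] h by auto
    qed
    moreover have "integrable \<pi> f" "integrable \<pi> (expect h f)"
      using f set h by (auto intro!: integrable_pmf_bounded[where C = C] expect_abs_le)
    ultimately show ?thesis using stat[of h] h by simp
  qed
  then have "\<forall>\<^sub>F h in at_right 0. measure_pmf.expectation \<pi> (\<lambda>x. (expect h f x - f x) / h) = 0"
    by (rule eventually_mono[OF eventually_at_right_less])
  then show "((\<lambda>h. measure_pmf.expectation \<pi> (\<lambda>x. (expect h f x - f x) / h)) \<longlongrightarrow> 0) (at_right 0)"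
    by (simp add: tendsto_eventually)
qed simp

text \<open>\<open>expect t f x\<close> decreases in \<open>t\<close>; its limit is unchanged by a
  further time shift, hence invariant under the semigroup and therefore harmonic.\<close>

lemma superharmonic_limit:
  assumes f: "\<And>y. y \<in> Zplus N \<Longrightarrow> 0 \<le> f y \<and> f y \<le> 1"
    and super: "\<And>y t. y \<in> Zplus N \<Longrightarrow> 0 \<le> t \<Longrightarrow> expect t f y \<le> f y"
  shows "\<exists>v. \<forall>x\<in>Zplus N. (\<lambda>m. expect (real m) f x) \<longlonglongrightarrow> v x \<and>
    0 \<le> v x \<and> v x \<le> f x \<and> gen v x = 0"
proof -
  have f1: "\<bar>f y\<bar> \<le> 1" if "y \<in> Zplus N" for y using f[OF that] by simp
  have ge0: "0 \<le> expect t f x" if "0 \<le> t" "x \<in> Zplus N" for t x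
    using f set_P[OF that] by (intro integral_nonneg_AE) (auto simp: AE_measure_pmf_iff)
  have anti: "expect t f x \<le> expect s f x" if "0 \<le> s" "s \<le> t" "x \<in> Zplus N" for s t x
  proof -
    have "expect (s + (t - s)) f x = expect s (expect (t - s) f) x"
      using f1 that by (intro expect_add) auto
    also have "\<dots> \<le> expect s f x"
      using f1 that super by (intro expect_mono[where C = 1 and D = 1] expect_abs_le) auto
    finally show ?thesis by simp
  qed
  define v where "v x = lim (\<lambda>m. expect (real m) f x)" for x
  have lim: "(\<lambda>m. expect (real m) f x) \<longlonglongrightarrow> v x" if x: "x \<in> Zplus N" for x
  proof -
    have "decseq (\<lambda>m. expect (real m) f x)" using anti x by (simp add: decseq_def)
    then obtain L where "(\<lambda>m. expect (real m) f x) \<longlonglongrightarrow> L"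
      using decseq_convergent[of _ 0] ge0[OF _ x] by (metis of_nat_0_le_iff)
    then show ?thesis unfolding v_def by (simp add: limI)
  qed
  have v: "0 \<le> v x \<and> v x \<le> f x" if x: "x \<in> Zplus N" for x
    using LIMSEQ_le_const[OF lim[OF x], of 0] LIMSEQ_le_const2[OF lim[OF x], of "f x"] ge0 super x
    by simp
  have v1: "\<bar>v x\<bar> \<le> 1" if "x \<in> Zplus N" for x using v[OF that] f[OF that] by simp
  have inv: "expect t v x = v x" if t: "0 \<le> t" and x: "x \<in> Zplus N" for t x
  proof (rule LIMSEQ_unique)
    show "(\<lambda>m. expect t (expect (real m) f) x) \<longlonglongrightarrow> expect t v x"
      using set_P[OF t x] f1 lim by (intro pmf_expectation_tendsto[where C = 1] expect_abs_le) auto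
    have eq: "expect t (expect (real m) f) x = expect (t + real m) f x" for m
      using f1 t x by (intro expect_add[symmetric]) auto
    \<comment> \<open>The limit runs over integer times only; for general \<open>t\<close>, the time
      \<open>t + real m\<close> is squeezed between \<open>real m\<close> and
      \<open>real (m + k)\<close>.\<close>
    obtain k where k: "t \<le> real k" using real_arch_simple by blast
    show "(\<lambda>m. expect t (expect (real m) f) x) \<longlonglongrightarrow> v x"
      unfolding eq
    proof (rule tendsto_sandwich)
      show "\<forall>\<^sub>F m in sequentially. expect (real (m + k)) f x \<le> expect (t + real m) f x"
        using anti t k x by (intro always_eventually allI) simp
      show "\<forall>\<^sub>F m in sequentially. expect (t + real m) f x \<le> expect (real m) f x"
        using anti t x by (intro always_eventually allI) simp
      show "(\<lambda>m. expect (real (m + k)) f x) \<longlonglongrightarrow> v x" by (rule LIMSEQ_ignore_initial_segment[OF lim[OF x]])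
    qed (rule lim[OF x])
  qed
  have "gen v x = 0" if "x \<in> Zplus N" for x
    using v1 inv that by (intro invariant_imp_harmonic[where C = 1]) auto
  then show ?thesis using lim v by blast
qed

end

section \<open>Paths of Markov processes\<close>

text \<open>Meaningful for measurable \<open>V\<close> on a probability space.\<close>

definition law :: "'w measure \<Rightarrow> ('w \<Rightarrow> 'a :: countable) \<Rightarrow> 'a pmf" where
  "law M V = Abs_pmf (distr M (count_space UNIV) V)"

lemma measure_pmf_law:
  fixes V :: "'w \<Rightarrow> 'a :: countable"
  assumes M: "prob_space M" and V: "V \<in> measurable M (count_space UNIV)"
  shows "measure_pmf (law M V) = distr M (count_space UNIV) V"
  unfolding law_def
proof (rule Abs_pmf_inverse, safe)
  let ?D = "distr M (count_space UNIV) V"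
  interpret D: prob_space ?D using M V by (rule prob_space.prob_space_distr)
  show "prob_space ?D" by (fact D.prob_space_axioms)
  \<comment> \<open>Countability makes the union of all null atoms a null set, which gives the
    almost-everywhere condition of a \<open>pmf\<close>.\<close>
  have "(\<Union>x\<in>{x. measure ?D {x} = 0}. {x}) \<in> null_sets ?D"
    by (intro null_sets_UN') (auto simp: null_sets_def D.emeasure_eq_measure)
  then show "AE x in ?D. measure ?D {x} \<noteq> 0"
    by (rule AE_I') auto
qed simp_all

lemma law_expectation:
  fixes V :: "'w \<Rightarrow> 'a :: countable" and f :: "'a \<Rightarrow> real"
  assumes "prob_space M" "V \<in> measurable M (count_space UNIV)"
  shows "measure_pmf.expectation (law M V) f = (\<integral>\<omega>. f (V \<omega>) \<partial>M)"
  using assms by (simp add: measure_pmf_law integral_distr)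

lemma measure_law:
  fixes V :: "'w \<Rightarrow> 'a :: countable"
  assumes "prob_space M" "V \<in> measurable M (count_space UNIV)"
  shows "measure (law M V) A = measure M {\<omega> \<in> space M. V \<omega> \<in> A}"
  using assms by (simp add: measure_pmf_law measure_distr vimage_def Int_def conj_commute)

locale countable_markov_process = prob_space M
  for M :: "'w measure" and S :: "'s :: countable set" and P :: "real \<Rightarrow> 's \<Rightarrow> 's pmf"
    and Y :: "real \<Rightarrow> 'w \<Rightarrow> 's" +
  assumes markov: "markov_process M S P Y"
begin

lemma Y_measurable_S: "0 \<le> t \<Longrightarrow> Y t \<in> measurable M (count_space S)"
  using markov by (simp add: markov_process_def)

lemma Y_in: "0 \<le> t \<Longrightarrow> \<omega> \<in> space M \<Longrightarrow> Y t \<omega> \<in> S"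
  using measurable_space[OF Y_measurable_S] by simp

lemma Y_measurable: "0 \<le> t \<Longrightarrow> Y t \<in> measurable M (count_space UNIV)"
  using measurable_compose[OF Y_measurable_S, of t "\<lambda>x. x" "count_space UNIV"] by simp

lemma Y_right_constant:
  "\<omega> \<in> space M \<Longrightarrow> 0 \<le> t \<Longrightarrow> \<forall>\<^sub>F s in at_right t. Y s \<omega> = Y t \<omega>"
  using markov by (simp add: markov_process_def cadlag_path_def)

lemma P_in: "0 \<le> t \<Longrightarrow> x \<in> S \<Longrightarrow> set_pmf (P t x) \<subseteq> S"
  using markov by (simp add: markov_process_def transition_function_def)

section \<open>Finite-dimensional distributions and a maximal inequality\<close>

definition trace :: "(nat \<Rightarrow> real) \<Rightarrow> nat \<Rightarrow> 'w \<Rightarrow> 's list" where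
  "trace t k \<omega> = map (\<lambda>i. Y (t i) \<omega>) [0..<Suc k]"

context
  fixes t :: "nat \<Rightarrow> real"
  assumes t_0: "0 \<le> t 0" and t_mono: "strict_mono t"
begin

lemma t_nonneg: "0 \<le> t i"
  using t_0 t_mono by (meson le0 order_trans strict_mono_less_eq)

lemma t_diff_pos: "0 \<le> t (Suc k) - t k"
  using t_mono by (simp add: strict_mono_less_eq)

lemma trace_eq_iff: "trace t k \<omega> = xs \<longleftrightarrow> length xs = Suc k \<and> (\<forall>i\<le>k. Y (t i) \<omega> = xs ! i)"
  unfolding trace_def list_eq_iff_nth_eq by (auto simp del: upt_Suc simp: less_Suc_eq_le)

lemma trace_measurable: "trace t k \<in> measurable M (count_space UNIV)"
proof (subst measurable_count_space_eq2_countable, safe)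
  fix xs
  have "{\<omega> \<in> space M. trace t k \<omega> = xs} \<in> sets M"
    unfolding trace_eq_iff using Y_measurable[OF t_nonneg]
    by measurable
  then show "trace t k -` {xs} \<inter> space M \<in> sets M" by (simp add: vimage_def Int_def conj_commute)
qed simp_all

lemma pmf_trace:
  "pmf (law M (trace t k)) xs =
    (if length xs = Suc k then measure M {\<omega> \<in> space M. \<forall>i\<le>k. Y (t i) \<omega> = xs ! i} else 0)"
  using measure_law[OF prob_space_axioms trace_measurable, of k "{xs}"]
  by (auto simp: measure_pmf_single trace_eq_iff)

lemma set_law_trace: "xs \<in> set_pmf (law M (trace t k)) \<Longrightarrow> length xs = Suc k \<and> set xs \<subseteq> S"
proof -
  assume "xs \<in> set_pmf (law M (trace t k))"
  then have "pmf (law M (trace t k)) xs \<noteq> 0" by (simp add: set_pmf_iff)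
  then have len: "length xs = Suc k" and "measure M {\<omega> \<in> space M. \<forall>i\<le>k. Y (t i) \<omega> = xs ! i} \<noteq> 0"
    by (auto simp: pmf_trace split: if_splits)
  then have "{\<omega> \<in> space M. \<forall>i\<le>k. Y (t i) \<omega> = xs ! i} \<noteq> {}" by (metis measure_empty)
  then obtain \<omega> where "\<omega> \<in> space M" "\<forall>i\<le>k. Y (t i) \<omega> = xs ! i" by blast
  then have "xs ! i \<in> S" if "i < Suc k" for i
    using Y_in[OF t_nonneg[of i]] that by (metis less_Suc_eq_le)
  with len show ?thesis by (auto simp: in_set_conv_nth)
qed

text \<open>The product formula for cylinder probabilities, read as composition of kernels: a trace
  grows by sampling from \<open>P\<close> at its last entry.\<close>

lemma law_trace_Suc:
  "law M (trace t (Suc k)) =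
    bind_pmf (law M (trace t k)) (\<lambda>xs. map_pmf (\<lambda>y. xs @ [y]) (P (t (Suc k) - t k) (last xs)))"
    (is "_ = bind_pmf ?p ?K")
proof (rule pmf_eqI)
  fix zs
  show "pmf (law M (trace t (Suc k))) zs = pmf (bind_pmf ?p ?K) zs"
  proof (cases zs rule: rev_cases)
    case Nil
    have "pmf (bind_pmf ?p ?K) [] = 0" by (auto simp: pmf_eq_0_set_pmf)
    then show ?thesis using Nil by (simp add: pmf_trace)
  next
    case (snoc xs y)
    have "pmf (?K xs') (xs @ [y]) = indicator {xs} xs' * pmf (P (t (Suc k) - t k) (last xs)) y" for xs'
    proof (cases "xs' = xs")
      case True
      then show ?thesis
        using pmf_map_inj'[of "\<lambda>y. xs @ [y]" "P (t (Suc k) - t k) (last xs)" y] by (simp add: inj_def)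
    next
      case False
      then have "xs @ [y] \<notin> set_pmf (?K xs')" by auto
      then show ?thesis using False by (simp add: pmf_eq_0_set_pmf)
    qed
    then have "pmf (bind_pmf ?p ?K) zs = pmf ?p xs * pmf (P (t (Suc k) - t k) (last xs)) y"
      by (simp add: snoc pmf_bind measure_pmf_single)
    also have "\<dots> = pmf (law M (trace t (Suc k))) zs"
    proof (cases "length xs = Suc k \<and> set zs \<subseteq> S")
      case True
      then have len: "length xs = Suc k" by simp
      have "\<forall>i\<le>Suc k. zs ! i \<in> S"
      proof (intro allI impI)
        fix i assume "i \<le> Suc k"
        then have "zs ! i \<in> set zs" using len snoc by (intro nth_mem) simp
        then show "zs ! i \<in> S" using True by blast
      qed
      moreover have "strict_mono_on {..Suc k} t" using t_mono by (simp add: strict_mono_on_def strict_mono_def)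
      ultimately have "measure M {\<omega> \<in> space M. \<forall>i\<le>Suc k. Y (t i) \<omega> = zs ! i} =
          measure M {\<omega> \<in> space M. \<forall>i\<le>k. Y (t i) \<omega> = zs ! i}
            * pmf (P (t (Suc k) - t k) (zs ! k)) (zs ! Suc k)"
        using markov t_0 unfolding markov_process_def by blast
      moreover have "zs ! k = last xs" "zs ! Suc k = y"
        using len snoc last_conv_nth[of xs] by (cases "xs = []"; simp add: nth_append)+
      moreover have "zs ! i = xs ! i" if "i \<le> k" for i using len snoc that by (simp add: nth_append)
      ultimately show ?thesis using len snoc by (simp add: pmf_trace cong: conj_cong)
    next
      \<comment> \<open>The Markov property speaks only of states in \<open>S\<close>. Otherwise
        both sides vanish, since traces have a fixed length and stay in \<open>S\<close>.\<close>
      case False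
      then have 0: "pmf (law M (trace t (Suc k))) zs = 0"
        using set_law_trace[of zs "Suc k"] snoc by (auto simp: pmf_eq_0_set_pmf)
      have "pmf ?p xs * pmf (P (t (Suc k) - t k) (last xs)) y = 0"
      proof (rule ccontr)
        assume "\<not> ?thesis"
        then have "xs \<in> set_pmf ?p" "y \<in> set_pmf (P (t (Suc k) - t k) (last xs))"
          by (auto simp: set_pmf_iff)
        moreover from this have "last xs \<in> S"
          using set_law_trace[of xs k] by (metis last_in_set length_0_conv nat.distinct(1) subsetD)
        ultimately have "length xs = Suc k \<and> set zs \<subseteq> S"
          using set_law_trace[of xs k] P_in[OF t_diff_pos] snoc by auto
        then show False using False by simp
      qed
      then show ?thesis using 0 by simp
    qed
    finally show ?thesis by simp
  qed
qed

lemma expectation_trace_Suc: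
  fixes F :: "'s list \<Rightarrow> real"
  assumes F: "\<And>xs. set xs \<subseteq> S \<Longrightarrow> \<bar>F xs\<bar> \<le> C"
  shows "measure_pmf.expectation (law M (trace t (Suc k))) F =
    measure_pmf.expectation (law M (trace t k))
      (\<lambda>xs. measure_pmf.expectation (P (t (Suc k) - t k) (last xs)) (\<lambda>y. F (xs @ [y])))"
proof -
  have "measure_pmf.expectation (law M (trace t (Suc k))) F =
    measure_pmf.expectation (law M (trace t k)) (\<lambda>xs. measure_pmf.expectation
      (map_pmf (\<lambda>y. xs @ [y]) (P (t (Suc k) - t k) (last xs))) F)"
    unfolding law_trace_Suc
  proof (rule pmf_expectation_bind_bounded)
    fix zs assume "zs \<in> set_pmf (bind_pmf (law M (trace t k))
      (\<lambda>xs. map_pmf (\<lambda>y. xs @ [y]) (P (t (Suc k) - t k) (last xs))))"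
    then show "\<bar>F zs\<bar> \<le> C"
      unfolding law_trace_Suc[symmetric] using set_law_trace F by blast
  qed
  then show ?thesis by simp
qed

lemma integral_markov_step:
  fixes h :: "'s \<Rightarrow> real"
  assumes h: "\<And>x. x \<in> S \<Longrightarrow> \<bar>h x\<bar> \<le> C"
  shows "(\<integral>\<omega>. h (Y (t (Suc 0)) \<omega>) \<partial>M) =
    (\<integral>\<omega>. measure_pmf.expectation (P (t (Suc 0) - t 0) (Y (t 0) \<omega>)) h \<partial>M)"
proof -
  \<comment> \<open>The bound has to cover the empty list too, where \<open>last []\<close> is an
    unspecified state; hence the maximum.\<close>
  have bound: "\<bar>h (last xs)\<bar> \<le> max C \<bar>h (last [])\<bar>" if "set xs \<subseteq> S" for xs
    using h[of "last xs"] last_in_set[of xs] that by (cases "xs = []") fastforce+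
  have "(\<integral>\<omega>. h (last (trace t (Suc 0) \<omega>)) \<partial>M) = (\<integral>\<omega>. measure_pmf.expectation
      (P (t (Suc 0) - t 0) (last (trace t 0 \<omega>))) h \<partial>M)"
    using expectation_trace_Suc[where F = "\<lambda>xs. h (last xs)" and k = 0, OF bound]
    by (simp add: law_expectation[OF prob_space_axioms trace_measurable])
  then show ?thesis by (simp add: trace_def)
qed

context
  fixes h :: "'s \<Rightarrow> real" and A :: "'s set"
  assumes h: "\<And>x. x \<in> S \<Longrightarrow> 0 \<le> h x \<and> h x \<le> 1" and h_A: "\<And>x. x \<in> S \<Longrightarrow> x \<in> A \<Longrightarrow> h x = 1"
    and super: "\<And>x t. x \<in> S \<Longrightarrow> 0 \<le> t \<Longrightarrow> measure_pmf.expectation (P t x) h \<le> h x"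
begin

lemma maximal_inequality:
  "measure M {\<omega> \<in> space M. \<exists>i\<le>k. Y (t i) \<omega> \<in> A} \<le> (\<integral>\<omega>. h (Y (t 0) \<omega>) \<partial>M)"
proof -
  \<comment> \<open>This is \<open>h\<close> along the path stopped at its first visit to
    \<open>A\<close>, where \<open>h\<close> equals 1: a supermartingale that dominates the
    indicator of a visit.\<close>
  define F where "F xs = (if \<exists>x\<in>set xs. x \<in> A then 1 else h (last xs))" for xs
  have F: "0 \<le> F xs \<and> F xs \<le> 1" if "set xs \<subseteq> S" "xs \<noteq> []" for xs
  proof -
    have "last xs \<in> S" using that by auto
    then show ?thesis using h[of "last xs"] by (auto simp: F_def)
  qed
  have F1: "\<bar>F xs\<bar> \<le> max 1 \<bar>h (last [])\<bar>" if "set xs \<subseteq> S" for xs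
    using F[OF that] by (cases "xs = []") (auto simp: F_def)
  have dec: "measure_pmf.expectation (law M (trace t (Suc k))) F \<le> measure_pmf.expectation (law M (trace t k)) F" for k
  proof (subst expectation_trace_Suc[where F = F, OF F1], assumption, rule pmf_expectation_mono[where C = 1 and D = 1])
    fix xs assume "xs \<in> set_pmf (law M (trace t k))"
    then have xs: "set xs \<subseteq> S" "xs \<noteq> []" using set_law_trace[of xs k] by auto
    then have last: "last xs \<in> S" by auto
    let ?q = "P (t (Suc k) - t k) (last xs)"
    have q: "set_pmf ?q \<subseteq> S" using t_diff_pos last by (rule P_in)
    show "\<bar>F xs\<bar> \<le> 1" using F[OF xs] by simp
    show "\<bar>measure_pmf.expectation ?q (\<lambda>y. F (xs @ [y]))\<bar> \<le> 1"
    proof (rule pmf_expectation_abs_le)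
      show "\<bar>F (xs @ [y])\<bar> \<le> 1" if "y \<in> set_pmf ?q" for y
        using F[of "xs @ [y]"] xs q that by auto
    qed
    show "measure_pmf.expectation ?q (\<lambda>y. F (xs @ [y])) \<le> F xs"
    proof (cases "\<exists>x\<in>set xs. x \<in> A")
      case True
      then show ?thesis by (auto simp: F_def)
    next
      case False
      then have "measure_pmf.expectation ?q (\<lambda>y. F (xs @ [y])) = measure_pmf.expectation ?q h"
        using q h_A by (intro pmf_expectation_cong) (auto simp: F_def)
      also have "\<dots> \<le> F xs" using super[OF last t_diff_pos] False by (simp add: F_def)
      finally show ?thesis .
    qed
  qed
  have "measure M {\<omega> \<in> space M. \<exists>i\<le>k. Y (t i) \<omega> \<in> A} = measure (law M (trace t k)) {xs. \<exists>x\<in>set xs. x \<in> A}"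
    unfolding measure_law[OF prob_space_axioms trace_measurable] trace_def
    by (intro arg_cong[where f = "measure M"]) (auto simp del: upt_Suc simp: less_Suc_eq_le)
  also have "\<dots> = measure_pmf.expectation (law M (trace t k)) (indicator {xs. \<exists>x\<in>set xs. x \<in> A})"
    by simp
  also have "\<dots> \<le> measure_pmf.expectation (law M (trace t k)) F"
  proof (rule pmf_expectation_mono[where C = 1 and D = 1])
    fix xs assume "xs \<in> set_pmf (law M (trace t k))"
    then have "set xs \<subseteq> S" "xs \<noteq> []" using set_law_trace[of xs k] by auto
    then show "\<bar>F xs\<bar> \<le> 1" "indicator {xs. \<exists>x\<in>set xs. x \<in> A} xs \<le> F xs"
      using F[of xs] by (auto simp: F_def indicator_def)
  qed (auto simp: indicator_def)
  also have "\<dots> \<le> measure_pmf.expectation (law M (trace t 0)) F"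
    by (induction k) (use dec in \<open>auto intro: order_trans\<close>)
  also have "\<dots> = (\<integral>\<omega>. F (trace t 0 \<omega>) \<partial>M)"
    by (rule law_expectation[OF prob_space_axioms trace_measurable])
  also have "\<dots> = (\<integral>\<omega>. h (Y (t 0) \<omega>) \<partial>M)"
    using h_A Y_in[OF t_0] by (intro Bochner_Integration.integral_cong) (auto simp: F_def trace_def)
  finally show ?thesis .
qed

end

end

section \<open>Visits after a given time, reduced to dyadic times\<close>

definition hits :: "'s set \<Rightarrow> real \<Rightarrow> 'w set" where
  "hits A T = {\<omega> \<in> space M. \<exists>s\<ge>T. Y s \<omega> \<in> A}"

text \<open>The grid has mesh \<open>1 / 2 ^ r\<close> and reaches up to \<open>T + r\<close>:
  refinement and horizon grow together, so a single increasing sequence of events exhausts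
  \<open>hits A T\<close>.\<close>

definition grid_hits :: "'s set \<Rightarrow> real \<Rightarrow> nat \<Rightarrow> 'w set" where
  "grid_hits A T r = {\<omega> \<in> space M. \<exists>i\<le>r * 2 ^ r. Y (T + real i / 2 ^ r) \<omega> \<in> A}"

lemma grid_hits_measurable: "0 \<le> T \<Longrightarrow> grid_hits A T r \<in> sets M"
  unfolding grid_hits_def using Y_measurable by measurable

lemma incseq_grid_hits: "incseq (grid_hits A T)"
proof (rule incseq_SucI, rule subsetI)
  fix r \<omega> assume "\<omega> \<in> grid_hits A T r"
  then obtain i where i: "\<omega> \<in> space M" "i \<le> r * 2 ^ r" "Y (T + real i / 2 ^ r) \<omega> \<in> A"
    by (auto simp: grid_hits_def)
  then have "2 * i \<le> Suc r * 2 ^ Suc r" "Y (T + real (2 * i) / 2 ^ Suc r) \<omega> \<in> A" by auto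
  then show "\<omega> \<in> grid_hits A T (Suc r)" using i(1) unfolding grid_hits_def by blast
qed

text \<open>By right continuity a visited state is held for a positive time, and a fine enough
  dyadic grid meets that interval.\<close>

lemma hits_eq_grid_hits:
  assumes T: "0 \<le> T"
  shows "hits A T = (\<Union>r. grid_hits A T r)"
proof (rule antisym; rule subsetI)
  fix \<omega> assume "\<omega> \<in> hits A T"
  then obtain s where s: "\<omega> \<in> space M" "T \<le> s" "Y s \<omega> \<in> A" by (auto simp: hits_def)
  obtain d where d: "s < d" "\<And>u. s < u \<Longrightarrow> u < d \<Longrightarrow> Y u \<omega> = Y s \<omega>"
    using Y_right_constant[OF s(1), of s] s T unfolding eventually_at_right_field by auto
  obtain r1 where r1: "(1 / 2) ^ r1 < d - s" using real_arch_pow_inv[of "d - s" "1 / 2"] d by auto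
  obtain r2 where r2: "s - T + 1 \<le> real r2" using real_arch_simple by blast
  define r where "r = max r1 r2"
  have "(1 / 2) ^ r \<le> (1 / 2 :: real) ^ r1" by (rule power_decreasing) (auto simp: r_def)
  then have small: "1 / 2 ^ r < d - s" using r1 by (simp add: power_one_over)
  \<comment> \<open>The first grid point strictly after \<open>s\<close>, so that the choice of
    \<open>d\<close> applies. It may overshoot \<open>s\<close> by one mesh, which the extra 1 in
    the choice of \<open>r2\<close> absorbs.\<close>
  define i where "i = Suc (nat \<lfloor>(s - T) * 2 ^ r\<rfloor>)"
  have i: "(s - T) * 2 ^ r < real i" "real i \<le> (s - T) * 2 ^ r + 1"
    using s by (auto simp: i_def intro: of_nat_floor) linarith
  have "s < T + real i / 2 ^ r" using i(1) by (simp add: field_simps)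
  moreover have "T + real i / 2 ^ r \<le> s + 1 / 2 ^ r"
    using divide_right_mono[OF i(2), of "2 ^ r"] by (simp add: add_divide_distrib)
  ultimately have "Y (T + real i / 2 ^ r) \<omega> = Y s \<omega>" using d small by auto
  moreover have "real i \<le> real (r * 2 ^ r)"
  proof -
    have "real i \<le> (s - T + 1) * 2 ^ r" using i(2) by (simp add: algebra_simps) (use one_le_power[of "2::real" r] in linarith)
    also have "\<dots> \<le> real r * 2 ^ r" using r2 by (intro mult_right_mono) (auto simp: r_def)
    finally show ?thesis by simp
  qed
  ultimately have "\<omega> \<in> grid_hits A T r" using s unfolding grid_hits_def of_nat_le_iff by auto
  then show "\<omega> \<in> (\<Union>r. grid_hits A T r)" by blast
next
  fix \<omega> assume "\<omega> \<in> (\<Union>r. grid_hits A T r)"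
  then obtain r i where "\<omega> \<in> space M" "Y (T + real i / 2 ^ r) \<omega> \<in> A"
    unfolding grid_hits_def by blast
  moreover have "T \<le> T + real i / 2 ^ r" by simp
  ultimately show "\<omega> \<in> hits A T" unfolding hits_def by blast
qed

lemma hits_measurable: "0 \<le> T \<Longrightarrow> hits A T \<in> sets M"
  unfolding hits_eq_grid_hits by (rule sets.countable_UN) (auto intro: grid_hits_measurable)

text \<open>The maximal inequality on the grid does not depend on the mesh, so it passes to the
  increasing union of the grid events.\<close>

lemma prob_hits_le:
  fixes h :: "'s \<Rightarrow> real"
  assumes h: "\<And>x. x \<in> S \<Longrightarrow> 0 \<le> h x \<and> h x \<le> 1" "\<And>x. x \<in> S \<Longrightarrow> x \<in> A \<Longrightarrow> h x = 1"
    and super: "\<And>x t. x \<in> S \<Longrightarrow> 0 \<le> t \<Longrightarrow> measure_pmf.expectation (P t x) h \<le> h x"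
    and T: "0 \<le> T"
  shows "prob (hits A T) \<le> (\<integral>\<omega>. h (Y T \<omega>) \<partial>M)"
proof -
  have "(\<lambda>r. prob (grid_hits A T r)) \<longlonglongrightarrow> prob (hits A T)"
    unfolding hits_eq_grid_hits[OF T]
    using incseq_grid_hits grid_hits_measurable[OF T] by (intro finite_Lim_measure_incseq) auto
  moreover have "prob (grid_hits A T r) \<le> (\<integral>\<omega>. h (Y T \<omega>) \<partial>M)" for r
    using maximal_inequality[of "\<lambda>i. T + real i / 2 ^ r" h A "r * 2 ^ r"] T h super
    by (simp add: grid_hits_def strict_mono_def divide_strict_right_mono)
  ultimately show ?thesis by (intro LIMSEQ_le_const2) auto
qed

lemma prob_avoids_eventually:
  fixes h :: "'s \<Rightarrow> real"
  assumes h: "\<And>x. x \<in> S \<Longrightarrow> 0 \<le> h x \<and> h x \<le> 1" "\<And>x. x \<in> S \<Longrightarrow> x \<in> A \<Longrightarrow> h x = 1"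
    and super: "\<And>x t. x \<in> S \<Longrightarrow> 0 \<le> t \<Longrightarrow> measure_pmf.expectation (P t x) h \<le> h x"
    and lim: "\<And>x. x \<in> S \<Longrightarrow> (\<lambda>m. measure_pmf.expectation (P (real m) x) h) \<longlonglongrightarrow> 0"
  shows "measure M {\<omega> \<in> space M. \<exists>s\<ge>0. \<forall>t\<ge>s. Y t \<omega> \<notin> A} = 1"
proof -
  have h1: "\<bar>h x\<bar> \<le> 1" if "x \<in> S" for x using h(1)[OF that] by simp
  let ?I = "\<Inter>m. hits A (real m)"
  have sets: "?I \<in> sets M" using hits_measurable by auto
  \<comment> \<open>The bound by the mean of \<open>h (Y m)\<close> is rewritten as an average over
    the initial law. Positivity of \<open>m\<close> makes the grid of multiples of \<open>m\<close>
    strictly increasing.\<close>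
  have "prob ?I \<le> measure_pmf.expectation (law M (Y 0)) (\<lambda>x. measure_pmf.expectation (P (real m) x) h)"
    if m: "0 < m" for m :: nat
  proof -
    have "prob ?I \<le> prob (hits A (real m))" using hits_measurable by (intro finite_measure_mono) auto
    also have "\<dots> \<le> (\<integral>\<omega>. h (Y (real m) \<omega>) \<partial>M)" using h super by (rule prob_hits_le) auto
    also have "\<dots> = (\<integral>\<omega>. measure_pmf.expectation (P (real m) (Y 0 \<omega>)) h \<partial>M)"
      using integral_markov_step[of "\<lambda>i. real i * real m" h 1] m h1 by (simp add: strict_mono_def)
    also have "\<dots> = measure_pmf.expectation (law M (Y 0)) (\<lambda>x. measure_pmf.expectation (P (real m) x) h)"
      by (rule law_expectation[symmetric]) (auto intro: prob_space_axioms Y_measurable)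
    finally show ?thesis .
  qed
  moreover have S0: "set_pmf (law M (Y 0)) \<subseteq> S"
  proof
    fix x assume "x \<in> set_pmf (law M (Y 0))"
    then have "measure M {\<omega> \<in> space M. Y 0 \<omega> = x} \<noteq> 0"
      using measure_law[OF prob_space_axioms Y_measurable, of 0 "{x}"]
      by (simp add: measure_pmf_single set_pmf_iff)
    then have "{\<omega> \<in> space M. Y 0 \<omega> = x} \<noteq> {}" by (metis measure_empty)
    then show "x \<in> S" using Y_in[of 0] by auto
  qed
  have "(\<lambda>m. measure_pmf.expectation (law M (Y 0)) (\<lambda>x. measure_pmf.expectation (P (real m) x) h))
      \<longlonglongrightarrow> measure_pmf.expectation (law M (Y 0)) (\<lambda>_. 0)"
  proof (rule pmf_expectation_tendsto)
    fix m x assume "x \<in> set_pmf (law M (Y 0))"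
    then have "set_pmf (P (real m) x) \<subseteq> S" using S0 by (intro P_in) auto
    then show "\<bar>measure_pmf.expectation (P (real m) x) h\<bar> \<le> 1"
      using h1 by (intro pmf_expectation_abs_le) auto
  qed (use S0 lim in auto)
  ultimately have "prob ?I \<le> measure_pmf.expectation (law M (Y 0)) (\<lambda>_. 0)"
    by (intro LIMSEQ_le_const) (auto intro!: exI[of _ 1])
  then have "prob ?I = 0" using measure_nonneg[of M ?I] by simp
  moreover have "{\<omega> \<in> space M. \<exists>s\<ge>0. \<forall>t\<ge>s. Y t \<omega> \<notin> A} = space M - ?I"
  proof -
    have "(\<exists>s\<ge>0. \<forall>t\<ge>s. Y t \<omega> \<notin> A) \<longleftrightarrow> (\<exists>m::nat. \<forall>t\<ge>real m. Y t \<omega> \<notin> A)" for \<omega>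
      by (meson of_nat_0_le_iff order_trans real_arch_simple)
    then show ?thesis by (auto simp: hits_def)
  qed
  ultimately show ?thesis using sets by (simp add: prob_compl)
qed

end

section \<open>Transience\<close>

context bd_extension
begin

context
  fixes \<pi> :: "nat list pmf"
  assumes set_\<pi>: "set_pmf \<pi> \<subseteq> Zplus n"
    and stationary: "\<And>f C. (\<And>y. y \<in> Zplus n \<Longrightarrow> \<bar>f y\<bar> \<le> C) \<Longrightarrow> measure_pmf.expectation \<pi> (base.gen f) = 0"
begin

lemma escape_from_low:
  assumes rate: "measure_pmf.expectation \<pi> (\<psi> n) < b n"
  obtains z where "z \<in> set_pmf \<pi>" "0 < full.avoid (low k) (z @ [Suc k])"
proof -
  have bn: "0 < b n" by (rule full.birth_pos) simp
  have bounds: "0 \<le> full.nohit (low k) m (z @ [u]) \<and> full.nohit (low k) m (z @ [u]) \<le> 1"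
    if "z \<in> Zplus n" for z u m
    using full.nohit_bounds[of "z @ [u]"] that by simp
  have abs1: "\<bar>full.nohit (low k) m (z @ [u])\<bar> \<le> 1" if "z \<in> Zplus n" for z u m
    using bounds[OF that] by simp
  define e where "e m = measure_pmf.expectation \<pi> (\<lambda>z. full.nohit (low k) m (z @ [Suc k]))" for m
  \<comment> \<open>\<open>nohit_low_sum\<close> is integrated against \<pi>: the horizontal term of
    each level has mean zero, which leaves a lower bound independent of the horizon
    \<open>m\<close>.\<close>
  have e: "1 - measure_pmf.expectation \<pi> (\<psi> n) / b n \<le> e m" for m
  proof -
    let ?G = "\<lambda>u. base.gen (\<lambda>z. full.nohit (low k) m (z @ [u]))"
    have G: "\<bar>?G u z\<bar> \<le> 2 * 1 * c" if "z \<in> Zplus n" for u z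
      by (rule base.gen_abs_le[OF _ that]) (rule abs1)
    have intG: "integrable \<pi> (?G u)" for u
      using G set_\<pi> by (intro integrable_pmf_bounded[where C = "2 * 1 * c"]) auto
    have int: "integrable \<pi> (\<lambda>z. full.nohit (low k) m (z @ [Suc k]))"
      using abs1 set_\<pi> by (intro integrable_pmf_bounded[where C = 1]) auto
    have int\<psi>: "integrable \<pi> (\<psi> n)"
      using \<psi>_bounds[of _ n] set_\<pi> by (intro integrable_pmf_bounded[where C = B]) auto
    have "measure_pmf.expectation \<pi> (\<lambda>z. (\<Sum>u=Suc k..Suc k + m. ?G u z) +
      b n * (1 - full.nohit (low k) m (z @ [Suc k]))) \<le> measure_pmf.expectation \<pi> (\<psi> n)"
      using nohit_low_sum[of _ k m] set_\<pi> intG int int\<psi>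
      by (intro integral_mono_AE) (auto simp: AE_measure_pmf_iff)
    also have "measure_pmf.expectation \<pi> (\<lambda>z. (\<Sum>u=Suc k..Suc k + m. ?G u z) +
        b n * (1 - full.nohit (low k) m (z @ [Suc k]))) =
      (\<Sum>u=Suc k..Suc k + m. measure_pmf.expectation \<pi> (?G u)) + b n * (1 - e m)"
      using intG int by (simp add: e_def)
    also have "(\<Sum>u=Suc k..Suc k + m. measure_pmf.expectation \<pi> (?G u)) = 0"
      using stationary[OF abs1] by (intro sum.neutral) auto
    finally show ?thesis using bn by (simp add: field_simps)
  qed
  have "e \<longlonglongrightarrow> measure_pmf.expectation \<pi> (\<lambda>z. full.avoid (low k) (z @ [Suc k]))"
    unfolding e_def
  proof (rule pmf_expectation_tendsto)
    show "\<bar>full.nohit (low k) m (z @ [Suc k])\<bar> \<le> 1" if "z \<in> set_pmf \<pi>" for m z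
      using abs1 that set_\<pi> by auto
    show "(\<lambda>m. full.nohit (low k) m (z @ [Suc k])) \<longlonglongrightarrow> full.avoid (low k) (z @ [Suc k])"
      if "z \<in> set_pmf \<pi>" for z
      using that set_\<pi> by (intro full.nohit_tendsto) auto
  qed
  then have "1 - measure_pmf.expectation \<pi> (\<psi> n) / b n
      \<le> measure_pmf.expectation \<pi> (\<lambda>z. full.avoid (low k) (z @ [Suc k]))"
    by (rule LIMSEQ_le_const) (use e in auto)
  moreover have "0 < 1 - measure_pmf.expectation \<pi> (\<psi> n) / b n"
    using rate bn by (simp add: field_simps)
  ultimately have pos: "0 < measure_pmf.expectation \<pi> (\<lambda>z. full.avoid (low k) (z @ [Suc k]))" by simp
  show ?thesis
  proof (rule ccontr)
    assume "\<not> thesis"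
    then have "full.avoid (low k) (z @ [Suc k]) \<le> 0" if "z \<in> set_pmf \<pi>" for z
      using \<open>\<And>z. z \<in> set_pmf \<pi> \<Longrightarrow> 0 < full.avoid (low k) (z @ [Suc k]) \<Longrightarrow> thesis\<close> that by fastforce
    then have "measure_pmf.expectation \<pi> (\<lambda>z. full.avoid (low k) (z @ [Suc k])) =
        measure_pmf.expectation \<pi> (\<lambda>_. 0)"
      using full.avoid_bounds set_\<pi> by (intro pmf_expectation_cong antisym) auto
    then show False using pos by simp
  qed
qed

text \<open>\<open>base.avoid {z}\<close> is subharmonic and its generator has \<pi>-mean zero, so
  the generator vanishes on the support of \<pi>, in particular at \<open>z\<close>. The function is
  then harmonic everywhere and zero at \<open>z\<close>, and \<open>harmonic_zero\<close>
  applies.\<close>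

lemma recurrent:
  assumes z: "z \<in> set_pmf \<pi>" and y: "y \<in> Zplus n"
  shows "base.avoid {z} y = 0"
proof (rule base.harmonic_zero[where z = z])
  have 0: "measure_pmf.expectation \<pi> (base.gen (base.avoid {z})) = 0"
    using base.avoid_abs_le by (rule stationary)
  have "AE y in \<pi>. base.gen (base.avoid {z}) y = 0"
  proof (subst integral_nonneg_eq_0_iff_AE[symmetric])
    have "\<bar>base.gen (base.avoid {z}) x\<bar> \<le> 2 * 1 * c" if "x \<in> Zplus n" for x
      by (rule base.gen_abs_le[OF _ that]) (rule base.avoid_abs_le)
    then show "integrable \<pi> (base.gen (base.avoid {z}))"
      using set_\<pi> by (intro integrable_pmf_bounded[where C = "2 * 1 * c"]) auto
  qed (use 0 base.gen_avoid_nonneg set_\<pi> in \<open>auto simp: AE_measure_pmf_iff\<close>)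
  then have "base.gen (base.avoid {z}) z = 0" using z by (simp add: AE_measure_pmf_iff)
  then show "base.gen (base.avoid {z}) x = 0" if "x \<in> Zplus n" for x
    using base.gen_avoid_eq_0[OF that, of "{z}"] by (cases "x = z") auto
qed (use z y set_\<pi> base.avoid_bounds in \<open>auto simp: base.avoid_in\<close>)

end

end

theorem proposition6:
  fixes n :: nat
    and b :: "nat \<Rightarrow> real"
    and \<phi> \<psi> :: "nat \<Rightarrow> nat list \<Rightarrow> real"
    and \<pi> :: "nat list pmf"
    and M :: "'w measure" and X :: "real \<Rightarrow> 'w \<Rightarrow> nat list"
    and M' :: "'v measure" and Y :: "real \<Rightarrow> 'v \<Rightarrow> nat list"
  assumes birth_pos: "\<And>i. i < n + 1 \<Longrightarrow> b i > 0"
    and death_nonneg: "\<And>i x. i < n + 1 \<Longrightarrow> x \<in> Zplus (n + 1) \<Longrightarrow> \<phi> i x \<ge> 0"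
    and death_bounded: "\<exists>B. \<forall>i<n + 1. \<forall>x\<in>Zplus (n + 1). \<phi> i x \<le> B"
    and death_dep: "\<And>i x. i < n + 1 \<Longrightarrow> x \<in> Zplus (n + 1) \<Longrightarrow> \<phi> i x = \<psi> i (take n x)"
    and X: "birth_death_process (n + 1) b \<phi> M X"
    and stable: "stable_process M (Zplus n) (\<lambda>t \<omega>. take n (X t \<omega>))"
    and stationary: "bd_stationary_distribution n b \<psi> \<pi>"
    and rate: "b n > (\<Sum>\<^sub>\<infinity>x\<in>Zplus n. \<psi> n x * pmf \<pi> x)"
    \<comment> \<open>\<open>Y\<close> has the dynamics of \<open>X\<close> and an arbitrary initial state\<close>
    and Y: "birth_death_process (n + 1) b \<phi> M' Y"
  shows "transient_process M' (UNIV :: nat set) (\<lambda>t \<omega>. Y t \<omega> ! n)"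
proof -
  obtain B0 where B0: "\<And>i x. i < Suc n \<Longrightarrow> x \<in> Zplus (Suc n) \<Longrightarrow> \<phi> i x \<le> B0"
    using death_bounded by auto
  \<comment> \<open>The maximum with 0 makes the sum below visibly nonnegative, and the
    \<open>+ 1\<close> then gives \<open>0 < c\<close>.\<close>
  define B where "B = max B0 0"
  define c where "c = (\<Sum>i<Suc n. b i + B) + 1"
  have "0 \<le> (\<Sum>i<Suc n. b i + B)"
    by (rule sum_nonneg) (use birth_pos in \<open>fastforce simp: B_def\<close>)
  then interpret bd_extension n b \<phi> \<psi> B c
    using birth_pos death_nonneg death_dep B0 by unfold_locales (auto simp: B_def c_def le_max_iff_disj)
  obtain P\<pi> where set_\<pi>: "set_pmf \<pi> \<subseteq> Zplus n" and P\<pi>: "transition_function (Zplus n) P\<pi>"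
    "has_transition_rates (Zplus n) P\<pi> (bd_rate n b \<psi>)" "\<And>t. 0 \<le> t \<Longrightarrow> bind_pmf \<pi> (P\<pi> t) = \<pi>"
    using stationary by (auto simp: bd_stationary_distribution_def)
  \<comment> \<open>The semigroup that comes with \<pi>; through \<open>stationary_gen\<close> it
    turns invariance of \<pi> into a statement about the generator alone.\<close>
  interpret stat: bd_semigroup n b \<psi> B c P\<pi>
    by unfold_locales (fact P\<pi>)+
  obtain P where P: "markov_process M' (Zplus (Suc n)) P Y"
    "has_transition_rates (Zplus (Suc n)) P (bd_rate (Suc n) b \<phi>)"
    using Y by (auto simp: birth_death_process_def)
  interpret sg: bd_semigroup "Suc n" b \<phi> B c P
    by unfold_locales (use P in \<open>auto simp: markov_process_def\<close>)
  interpret M': prob_space M' using P by (simp add: markov_process_def)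
  interpret countable_markov_process M' "Zplus (Suc n)" P Y
    by unfold_locales (fact P)
  have "(\<Sum>\<^sub>\<infinity>x\<in>Zplus n. \<psi> n x * pmf \<pi> x) = measure_pmf.expectation \<pi> (\<psi> n)"
    using set_\<pi> \<psi>_bounds[of _ n] by (intro infsum_pmf_eq_expectation[where C = B]) auto
  then have rate': "measure_pmf.expectation \<pi> (\<psi> n) < b n" using rate by simp
  have stat0: "measure_pmf.expectation \<pi> (base.gen f) = 0"
    if "\<And>y. y \<in> Zplus n \<Longrightarrow> \<bar>f y\<bar> \<le> C" for f C
    using set_\<pi> P\<pi>(3) that by (rule stat.stationary_gen)
  show ?thesis
    unfolding transient_process_def
  proof (intro allI impI)
    fix K :: "nat set" assume "finite K \<and> K \<subseteq> UNIV"
    then obtain k where k: "K \<subseteq> {..k}" using finite_nat_iff_bounded_le by auto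
    obtain z where z: "z \<in> set_pmf \<pi>" "0 < full.avoid (low k) (z @ [Suc k])"
      using set_\<pi> stat0 rate' by (rule escape_from_low)
    define h where "h x = 1 - full.avoid (low k) x" for x
    have h: "0 \<le> h x \<and> h x \<le> 1" if "x \<in> Zplus (Suc n)" for x
      using full.avoid_bounds[OF that, of "low k"] by (simp add: h_def)
    have super: "measure_pmf.expectation (P t x) h \<le> h x" if x: "x \<in> Zplus (Suc n)" and t: "0 \<le> t" for x t
    proof -
      have "full.avoid (low k) x \<le> measure_pmf.expectation (P t x) (full.avoid (low k))"
        using full.avoid_abs_le full.gen_avoid_nonneg t x by (rule sg.subharmonic_imp_expect_ge)
      moreover have "integrable (P t x) (full.avoid (low k))"
        using full.avoid_abs_le t x by (rule sg.integrable_P)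
      ultimately show ?thesis unfolding h_def by simp
    qed
    obtain v where v: "\<forall>x\<in>Zplus (Suc n). (\<lambda>m. measure_pmf.expectation (P (real m) x) h) \<longlonglongrightarrow> v x \<and>
        0 \<le> v x \<and> v x \<le> h x \<and> full.gen v x = 0"
      using sg.superharmonic_limit[OF h super] by blast
    have "v x = 0" if "x \<in> Zplus (Suc n)" for x
    proof (rule bounded_harmonic_zero[where z = z and k = k])
      show "base.avoid {z} y = 0" if "y \<in> Zplus n" for y
        using set_\<pi> stat0 z(1) that by (rule recurrent)
    qed (use z v set_\<pi> that in \<open>auto simp: h_def\<close>)
    then have lim: "\<And>x. x \<in> Zplus (Suc n) \<Longrightarrow> (\<lambda>m. measure_pmf.expectation (P (real m) x) h) \<longlonglongrightarrow> 0"
      using v by metis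
    \<comment> \<open>The set to be left has last coordinate in \<open>K\<close>, hence lies in
      \<open>low k\<close>, where \<open>h = 1\<close>.\<close>
    have "measure M' {\<omega> \<in> space M'. \<exists>s\<ge>0. \<forall>t\<ge>s. Y t \<omega> \<notin> {x. x ! n \<in> K}} = 1"
      using h _ super lim
    proof (rule prob_avoids_eventually)
      show "h x = 1" if "x \<in> {x. x ! n \<in> K}" for x
        using that k by (auto simp: h_def full.avoid_in)
    qed
    then show "measure M' {\<omega> \<in> space M'. \<exists>s\<ge>0. \<forall>t\<ge>s. Y t \<omega> ! n \<notin> K} = 1" by simp
  qed
qed

end
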